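(* Let $1\le k\le n-1$ and let $w\in S_n$ have length $k$. The Hessenberg coefficient $m^{(n)}_{(k),w}$ (equivalently, the coefficient of the Schubert class $[\Omega_w]$ in the class in $H^*(\mathrm{Fl}(n))$ of a regular semisimple Hessenberg variety associated to the one-row partition $(k)$) is the number of restricted paths from $w$ to a permutation of the form $s_{n-p}s_{n-p-1}\cdots s_{n-k}$, where $p$ is the number of terms in the path. (Here $1\le p\le k+1$, and the product is the identity when $p=k+1$.)
   Context: Permutations: $\ell(w)$ is the number of inversions, $s_i=(i\ i{+}1)$, $s_{1j}=(1\ j)$, $w_0(i)=n+1-i$; products are composed as functions, so $s_1s_2=[2,3,1]$ in one-line notation in $S_3$. Restricted paths: a restricted path with $p$ terms from $u$ to $v$ is a sequence of permutations in $S_n$, $u=u_1,u_2,\ldots,u_p=v$, such that for each $1\le i<p$, $\ell(u_{i+1})=\ell(u_i)-1$ and $u_{i+1}=u_i\cdot s_{1j}$ for some $j\geq 2$. Schubert polynomials: $\partial_iP(x;y)=\frac{P(x;y)-P(\ldots,x_{i+1},x_i,\ldots;y)}{x_i-x_{i+1}}$; the double Schubert polynomials are given by $\mathfrak{S}_{w_0}(x;y)=\prod_{i+j\le n}(x_i-y_j)$ and $\partial_i\mathfrak{S}_w=\mathfrak{S}_{ws_i}$ if $\ell(ws_i)<\ell(w)$, and $0$ otherwise; $\mathfrak{S}_w(x)=\mathfrak{S}_w(x;0)$. The polynomials $\mathfrak{S}_u(x)$, for $u\in S_\infty=\bigcup_m S_m$ with $u(i)<u(i+1)$ for all $i>n$,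 form a $\mathbb{Z}$-basis of $\mathbb{Z}[x_1,\ldots,x_n]$. Hessenberg coefficients: for $\lambda=(k)$ the dominant permutation is $w(\lambda)=[k+1,1,2,\ldots,k,k+2,\ldots,n]$, and $$\mathfrak{S}_{w(\lambda)}(x_1,\ldots,x_n;x_n,\ldots,x_1)=(x_1-x_n)(x_1-x_{n-1})\cdots(x_1-x_{n+1-k}).$$ The integers $m^{(n)}_{(k),u}$ are the coefficients of $\mathfrak{S}_u(x)$ in the expansion of this polynomial in the basis of Schubert polynomials. Geometric meaning: $\mathrm{Fl}(n)$ is the variety of complete flags in $\mathbb{C}^n$; with $r_w(q,p)=\#\{i\le q:w(i)\le p\}$ and a fixed flag $E_\bullet$, $\Omega_w=\{F_\bullet:\dim(E_p\cap F_q)\ge r_{ww_0}(q,p)\ \forall p,q\}$. A regular semisimple Hessenberg variety associated to $(k)$ is $\{F_\bullet: X(F_i)\subseteq F_{h(i)}\ \forall i\}$ where $X$ is a linear endomorphism of $\mathbb{C}^n$ with $n$ distinct eigenvalues, $h(i)=n-1$ for $i\le k$ and $h(i)=n$ for $i>k$. Its class in $H^*(\mathrm{Fl}(n))$ is $\sum_{u\in S_n}m^{(n)}_{(k),u}[\Omega_u]$. *)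

theory Defs
  imports "HOL-Library.Poly_Mapping" "HOL-Combinatorics.Permutations"
begin

subsection \<open>Permutations\<close>

text \<open>Permutations in $S_n$ are functions \<open>w\<close> with \<open>w permutes {1..n}\<close>, so that $S_n$ is literally a
  subset of $S_{n+1}$, and the product is function composition.\<close>

definition S_inf :: "(nat \<Rightarrow> nat) set" where
  "S_inf = {w. \<exists>n. w permutes {1..n}}"

definition inversions :: "(nat \<Rightarrow> nat) \<Rightarrow> nat" where
  "inversions w = card {(i, j). i < j \<and> w j < w i}"

definition simple_transp :: "nat \<Rightarrow> nat \<Rightarrow> nat" where
  "simple_transp i = transpose i (i + 1)"

definition longest_perm :: "nat \<Rightarrow> nat \<Rightarrow> nat" where
  "longest_perm n i = (if i \<in> {1..n} then n + 1 - i else i)"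

text \<open>The product $s_b s_{b-1} \cdots s_a$, which is the identity if $b < a$.\<close>

definition descending_product :: "nat \<Rightarrow> nat \<Rightarrow> nat \<Rightarrow> nat" where
  "descending_product b a = foldr (\<circ>) (map simple_transp (rev [a..<b + 1])) id"

text \<open>A restricted path is the list of its terms; its number of terms is the length of the list.\<close>

definition restricted_path ::
  "nat \<Rightarrow> (nat \<Rightarrow> nat) list \<Rightarrow> (nat \<Rightarrow> nat) \<Rightarrow> (nat \<Rightarrow> nat) \<Rightarrow> bool" where
  "restricted_path n us u v \<longleftrightarrow>
     us \<noteq> [] \<and> hd us = u \<and> last us = v \<and> (\<forall>x\<in>set us. x permutes {1..n}) \<and>
     (\<forall>i. i + 1 < length us \<longrightarrow>
        inversions (us ! (i + 1)) + 1 = inversions (us ! i) \<and>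
        (\<exists>j\<in>{2..n}. us ! (i + 1) = us ! i \<circ> transpose 1 j))"

subsection \<open>Polynomials\<close>

text \<open>Polynomials with integer coefficients in $x_1, x_2, \ldots$ and $y_1, y_2, \ldots$ are finitely
  supported functions from monomials to coefficients; a monomial is the finitely supported function
  giving the exponent of each variable. (The variables $x_0$ and $y_0$ exist but do not occur.)\<close>

datatype var = VX nat | VY nat

type_synonym xypoly = "(var \<Rightarrow>\<^sub>0 nat) \<Rightarrow>\<^sub>0 int"

definition pvar :: "var \<Rightarrow> xypoly" where
  "pvar v = Poly_Mapping.single (Poly_Mapping.single v 1) 1"

abbreviation px :: "nat \<Rightarrow> xypoly" where "px i \<equiv> pvar (VX i)"
abbreviation py :: "nat \<Rightarrow> xypoly" where "py j \<equiv> pvar (VY j)"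

definition psubst :: "(var \<Rightarrow> xypoly) \<Rightarrow> xypoly \<Rightarrow> xypoly" where
  "psubst f P = (\<Sum>m\<in>Poly_Mapping.keys P. of_int (Poly_Mapping.lookup P m) *
     (\<Prod>v\<in>Poly_Mapping.keys m. f v ^ Poly_Mapping.lookup m v))"

fun subst_xy :: "(nat \<Rightarrow> xypoly) \<Rightarrow> (nat \<Rightarrow> xypoly) \<Rightarrow> var \<Rightarrow> xypoly" where
  "subst_xy f g (VX i) = f i"
| "subst_xy f g (VY j) = g j"

definition swap_x :: "nat \<Rightarrow> xypoly \<Rightarrow> xypoly" where
  "swap_x i = psubst (subst_xy (\<lambda>k. px (simple_transp i k)) py)"

text \<open>The quotient of $P - P(\ldots,x_{i+1},x_i,\ldots)$ by $x_i - x_{i+1}$, which exists and is unique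
  in the polynomial ring.\<close>

definition divided_difference :: "nat \<Rightarrow> xypoly \<Rightarrow> xypoly" where
  "divided_difference i P = (THE Q. Q * (px i - px (i + 1)) = P - swap_x i P)"

subsection \<open>Schubert polynomials\<close>

text \<open>The defining conditions, for all $S_n$ simultaneously. Every element of $S_\infty$ is reached from
  some $w_0 \in S_n$ by descents, so the conditions determine the family on $S_\infty$; outside of it
  the family is normalised to 0.\<close>

definition double_schubert_family :: "((nat \<Rightarrow> nat) \<Rightarrow> xypoly) \<Rightarrow> bool" where
  "double_schubert_family S \<longleftrightarrow>
     (\<forall>n. S (longest_perm n) = (\<Prod>(i, j)\<in>{(i, j). 1 \<le> i \<and> 1 \<le> j \<and> i + j \<le> n}. px i - py j)) \<and>
     (\<forall>w\<in>S_inf. \<forall>i\<ge>1. divided_difference i (S w) =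
        (if inversions (w \<circ> simple_transp i) < inversions w then S (w \<circ> simple_transp i) else 0)) \<and>
     (\<forall>w. w \<notin> S_inf \<longrightarrow> S w = 0)"

definition double_schubert :: "(nat \<Rightarrow> nat) \<Rightarrow> xypoly" where
  "double_schubert = (THE S. double_schubert_family S)"

definition schubert :: "(nat \<Rightarrow> nat) \<Rightarrow> xypoly" where
  "schubert w = psubst (subst_xy px (\<lambda>j. 0)) (double_schubert w)"

subsection \<open>Hessenberg coefficients\<close>

text \<open>$w((k)) = [k+1, 1, 2, \ldots, k, k+2, \ldots]$\<close>

definition dominant_perm :: "nat \<Rightarrow> nat \<Rightarrow> nat" where
  "dominant_perm k i =
     (if i = 1 then k + 1 else if i \<in> {2..k + 1} then i - 1 else i)"

text \<open>$\mathfrak{S}_{w((k))}(x_1,\ldots,x_n;x_n,\ldots,x_1)$, i.e.\ the substitution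
  $y_j \mapsto x_{n+1-j}$. For $k < n$ the variables $y_j$ with $j > n$ do not occur.\<close>

definition hessenberg_poly :: "nat \<Rightarrow> nat \<Rightarrow> xypoly" where
  "hessenberg_poly n k =
     psubst (subst_xy px (\<lambda>j. px (n + 1 - j))) (double_schubert (dominant_perm k))"

definition schubert_index :: "nat \<Rightarrow> (nat \<Rightarrow> nat) set" where
  "schubert_index n = {u \<in> S_inf. \<forall>i>n. u i < u (i + 1)}"

text \<open>The coefficients of the expansion in the basis \<open>schubert u\<close>, \<open>u \<in> schubert_index n\<close>, of
  $\mathbb{Z}[x_1,\ldots,x_n]$.\<close>

definition hessenberg_expansion :: "nat \<Rightarrow> nat \<Rightarrow> (nat \<Rightarrow> nat) \<Rightarrow>\<^sub>0 int" where
  "hessenberg_expansion n k = (THE c. Poly_Mapping.keys c \<subseteq> schubert_index n \<and>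
     hessenberg_poly n k =
       (\<Sum>u\<in>Poly_Mapping.keys c. of_int (Poly_Mapping.lookup c u) * schubert u))"

definition hessenberg_coeff :: "nat \<Rightarrow> nat \<Rightarrow> (nat \<Rightarrow> nat) \<Rightarrow> int" where
  "hessenberg_coeff n k u = Poly_Mapping.lookup (hessenberg_expansion n k) u"

end

theory Submission
  imports Defs
begin

text \<open>
  For a permutation \<open>w\<close> let $c_w(f)$ be the constant term of the divided difference $\partial_w f$. These
  functionals are dual to the Schubert polynomials, so the Hessenberg coefficient of \<open>w\<close> is $c_w$
  applied to $\prod_{i=m+1}^{n} (x_1 - x_i)$, where $m = n - k$ (\<open>hessenberg_coeff_eq\<close>).

  For $w \in S_n$ the operator $\partial_w$ is linear over symmetric polynomials in $x_1, \ldots, x_n$, so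
  $c_w$ vanishes on the ideal that those without constant term generate. Modulo this ideal
  $\prod_{i=1}^n (1 - x_i t) = 1$, and comparing coefficients gives
  $$\prod_{i=m+1}^{n} (x_1 - x_i) \equiv \sum_{b=0}^{k} x_1^{k-b} \, h_b(x_1, \ldots, x_m)$$
  (\<open>path_poly_congruence\<close>). Here $h_b(x_1, \ldots, x_m)$ is the Schubert polynomial of
  $s_{m+b-1} \cdots s_m$, so $c_u$ takes the value 1 on it if \<open>u\<close> is this permutation and 0 otherwise
  (\<open>schubert_coeff_complete_sym\<close>). The Chevalley--Monk rule in dual form says that $c_w(x_1 f)$ is
  the sum of $c_{w s_{1j}}(f)$ over all $w s_{1j}$ of length one less
  (\<open>schubert_coeff_px_1_mult\<close>). Hence $c_w(x_1^{p-1} f)$ is the sum of $c_u(f)$ over all restricted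
  paths with \<open>p\<close> terms from \<open>w\<close>, where \<open>u\<close> is the end of the path. With $p = k - b + 1$ this counts
  the paths that end in $s_{n-p} \cdots s_{n-k}$.

  The objects involved are given by definite descriptions, so their existence and uniqueness come
  first. Operators that satisfy the commutation and braid relations can be composed along the descents
  of a permutation, and the result does not depend on the choice of descents
  (\<open>along_descents_step\<close>); this yields both $\partial_w$ and, for each \<open>n\<close>, the double Schubert
  polynomials for $S_n$. The families for different \<open>n\<close> agree because the double Schubert polynomial
  of a dominant permutation is the product of $x_i - y_j$ over a Young diagram
  (\<open>schubert_in_dominant\<close>). Expansions in Schubert polynomials exist because a homogeneous polynomial
  on which all $c_u$ vanish has only zero divided differences, by induction on the degree; it is then
  symmetric in infinitely many variables and so constant (\<open>homogeneous_eq_0I\<close>).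
\<close>

section \<open>Substitution in polynomials\<close>

text \<open>With the variables linearly ordered, the monomials carry a compatible linear order, so the
  polynomial ring has no zero divisors. Uniqueness of the quotient by $x_i - x_{i+1}$ rests on this.\<close>

instantiation var :: linorder
begin

fun less_eq_var :: "var \<Rightarrow> var \<Rightarrow> bool" where
  "less_eq_var (VX i) (VX j) \<longleftrightarrow> i \<le> j"
| "less_eq_var (VX i) (VY j) \<longleftrightarrow> True"
| "less_eq_var (VY i) (VX j) \<longleftrightarrow> False"
| "less_eq_var (VY i) (VY j) \<longleftrightarrow> i \<le> j"

definition less_var :: "var \<Rightarrow> var \<Rightarrow> bool" where
  "less_var a b \<longleftrightarrow> a \<le> b \<and> \<not> b \<le> a"

instance
proof
  fix a b c :: var
  show "a < b \<longleftrightarrow> a \<le> b \<and> \<not> b \<le> a" by (rule less_var_def)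
  show "a \<le> a" by (cases a) auto
  show "a \<le> c" if "a \<le> b" "b \<le> c" using that by (cases a; cases b; cases c) auto
  show "a = b" if "a \<le> b" "b \<le> a" using that by (cases a; cases b) auto
  show "a \<le> b \<or> b \<le> a" by (cases a; cases b) auto
qed

end

definition monomial_value :: "(var \<Rightarrow> xypoly) \<Rightarrow> (var \<Rightarrow>\<^sub>0 nat) \<Rightarrow> xypoly" where
  "monomial_value f m = (\<Prod>v\<in>Poly_Mapping.keys m. f v ^ Poly_Mapping.lookup m v)"

lemma monomial_value_superset:
  assumes "finite V" "Poly_Mapping.keys m \<subseteq> V"
  shows "monomial_value f m = (\<Prod>v\<in>V. f v ^ Poly_Mapping.lookup m v)"
  unfolding monomial_value_def
  by (rule prod.mono_neutral_left) (use assms in \<open>auto simp: in_keys_iff\<close>)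

lemma monomial_value_add: "monomial_value f (m + m') = monomial_value f m * monomial_value f m'"
proof -
  define V where "V = Poly_Mapping.keys m \<union> Poly_Mapping.keys m'"
  have "finite V" "Poly_Mapping.keys m \<subseteq> V" "Poly_Mapping.keys m' \<subseteq> V" 
    "Poly_Mapping.keys (m + m') \<subseteq> V"
    using Poly_Mapping.keys_add[of m m'] by (auto simp: V_def)
  then show ?thesis
    by (simp add: monomial_value_superset[of V] prod.distrib lookup_add power_add)
qed

lemma psubst_superset:
  assumes "finite M" "Poly_Mapping.keys P \<subseteq> M"
  shows "psubst f P = (\<Sum>m\<in>M. of_int (Poly_Mapping.lookup P m) * monomial_value f m)"
  unfolding psubst_def monomial_value_def
  by (rule sum.mono_neutral_left) (use assms in \<open>auto simp: in_keys_iff\<close>)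

lemma psubst_add: "psubst f (P + Q) = psubst f P + psubst f Q"
proof -
  define M where "M = Poly_Mapping.keys P \<union> Poly_Mapping.keys Q"
  have "finite M" "Poly_Mapping.keys P \<subseteq> M" "Poly_Mapping.keys Q \<subseteq> M" 
    "Poly_Mapping.keys (P + Q) \<subseteq> M"
    using Poly_Mapping.keys_add[of P Q] by (auto simp: M_def)
  then show ?thesis
    by (simp add: psubst_superset[of M] sum.distrib lookup_add distrib_right)
qed

lemma psubst_single: "psubst f (Poly_Mapping.single m c) = of_int c * monomial_value f m"
  by (subst psubst_superset[of "{m}"]) (auto)

lemma psubst_0 [simp]: "psubst f 0 = 0"
  by (simp add: psubst_def)

lemma xypoly_sum_singles_induct [case_names zero add]:
  assumes "Q (0 :: xypoly)" "\<And>m c P. Q P \<Longrightarrow> Q (Poly_Mapping.single m c + P)"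
  shows "Q P"
proof -
  have "Q (\<Sum>m\<in>M. Poly_Mapping.single m (Poly_Mapping.lookup P m))" if "finite M" for M
    using that by induction (auto intro: assms)
  moreover have "P = (\<Sum>m\<in>Poly_Mapping.keys P. Poly_Mapping.single m (Poly_Mapping.lookup P m))"
    by (rule poly_mapping_eqI)
      (auto simp: lookup_sum lookup_single when_def sum.delta in_keys_iff)
  ultimately show ?thesis by (metis finite_keys)
qed

lemma psubst_mult: "psubst f (P * Q) = psubst f P * psubst f Q"
proof (induction P rule: xypoly_sum_singles_induct)
  case (add m c P)
  have "psubst f (Poly_Mapping.single m c * Q) = psubst f (Poly_Mapping.single m c) * psubst f Q"
    by (induction Q rule: xypoly_sum_singles_induct)
      (auto simp: psubst_add distrib_left mult_single psubst_single monomial_value_add algebra_simps)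
  with add show ?case by (simp add: psubst_add distrib_right)
qed auto

lemma psubst_of_int [simp]: "psubst f (of_int c) = of_int c"
  by (simp add: psubst_single monomial_value_def flip: single_of_int)

lemma psubst_1 [simp]: "psubst f 1 = 1"
  using psubst_of_int[of f 1] by simp

lemma psubst_pvar [simp]: "psubst f (pvar v) = f v"
  by (simp add: pvar_def psubst_single monomial_value_def)

lemma psubst_uminus: "psubst f (- P) = - psubst f P"
  using psubst_add[of f P "-P"] by (simp add: add_eq_0_iff)

lemma psubst_diff: "psubst f (P - Q) = psubst f P - psubst f Q"
  using psubst_add[of f P "-Q"] by (simp add: psubst_uminus)

lemma psubst_numeral [simp]: "psubst f (numeral c) = numeral c"
  using psubst_of_int[of f "numeral c"] by simp

lemma psubst_power: "psubst f (P ^ k) = psubst f P ^ k"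
  by (induction k) (auto simp: psubst_mult)

lemma psubst_sum: "psubst f (sum g A) = (\<Sum>a\<in>A. psubst f (g a))"
  by (induction A rule: infinite_finite_induct) (auto simp: psubst_add)

lemma psubst_prod: "psubst f (prod g A) = (\<Prod>a\<in>A. psubst f (g a))"
  by (induction A rule: infinite_finite_induct) (auto simp: psubst_mult)

lemmas psubst_simps = psubst_add psubst_mult psubst_uminus psubst_diff psubst_power psubst_sum psubst_prod

lemma monomial_eq_product:
  "Poly_Mapping.single m 1 = monomial_value pvar m"
proof -
  have pow: "pvar v ^ k = Poly_Mapping.single (Poly_Mapping.single v k) 1" for v k
    by (induction k) (auto simp: pvar_def mult_single single_add[symmetric])
  have "(\<Prod>v\<in>V. Poly_Mapping.single (g v) (1::int)) = Poly_Mapping.single (\<Sum>v\<in>V. g v) 1"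
    for V and g :: "var \<Rightarrow> var \<Rightarrow>\<^sub>0 nat"
    by (induction V rule: infinite_finite_induct) (auto simp: mult_single)
  moreover have "m = (\<Sum>v\<in>Poly_Mapping.keys m. Poly_Mapping.single v (Poly_Mapping.lookup m v))"
    by (rule poly_mapping_eqI)
      (auto simp: lookup_sum lookup_single when_def sum.delta in_keys_iff)
  ultimately show ?thesis
    by (simp add: monomial_value_def pow)
qed

text \<open>Substitutions are ring homomorphisms, so identities between them need only be checked on
  constants and variables.\<close>

lemma xypoly_induct [case_names const var add mult]:
  assumes "\<And>c. Q (of_int c)" "\<And>v. Q (pvar v)"
    and "\<And>A B. Q A \<Longrightarrow> Q B \<Longrightarrow> Q (A + B)" "\<And>A B. Q A \<Longrightarrow> Q B \<Longrightarrow> Q (A * B)"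
  shows "Q P"
proof (induction P rule: xypoly_sum_singles_induct)
  case zero
  then show ?case using assms(1)[of 0] by simp
next
  case (add m c P)
  have one: "Q 1" using assms(1)[of 1] by simp
  have pow: "Q (pvar v ^ k)" for v k
    by (induction k) (auto intro: assms one)
  have "Q (\<Prod>v\<in>V. pvar v ^ Poly_Mapping.lookup m v)" for V
    by (induction V rule: infinite_finite_induct) (auto intro: assms one pow)
  then have "Q (Poly_Mapping.single m 1)"
    by (simp add: monomial_eq_product monomial_value_def)
  moreover have "Poly_Mapping.single m c = of_int c * Poly_Mapping.single m 1"
    by (simp add: mult_single flip: single_of_int)
  ultimately show ?case
    using add by (auto intro!: assms)
qed

lemma psubst_psubst: "psubst f (psubst g P) = psubst (\<lambda>v. psubst f (g v)) P"
  by (induction P rule: xypoly_induct) (auto simp: psubst_simps)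

definition poly_vars :: "xypoly \<Rightarrow> var set" where
  "poly_vars P = (\<Union>m\<in>Poly_Mapping.keys P. Poly_Mapping.keys m)"

lemma finite_poly_vars [simp]: "finite (poly_vars P)"
  by (simp add: poly_vars_def)

lemma psubst_cong:
  assumes "\<And>v. v \<in> poly_vars P \<Longrightarrow> f v = g v"
  shows "psubst f P = psubst g P"
  unfolding psubst_def
  by (intro sum.cong arg_cong2[where f = "(*)"] prod.cong refl)
    (metis UN_I assms poly_vars_def)

lemma psubst_pvar_id [simp]: "psubst pvar P = P"
  by (induction P rule: xypoly_induct) (auto simp: psubst_simps)

definition const_term :: "xypoly \<Rightarrow> int" where
  "const_term P = Poly_Mapping.lookup P 0"

lemma psubst_zero: "psubst (\<lambda>_. 0) P = of_int (const_term P)"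
proof -
  have *: "monomial_value (\<lambda>_. 0) m = (if m = 0 then 1 else 0)" for m
  proof (cases "m = 0")
    case False
    then obtain v where "v \<in> Poly_Mapping.keys m"
      by (metis poly_mapping_eqI in_keys_iff lookup_zero)
    then have "(0::xypoly) ^ Poly_Mapping.lookup m v = 0" by (auto simp: in_keys_iff)
    with \<open>v \<in> _\<close> have "monomial_value (\<lambda>_. 0) m = 0"
      unfolding monomial_value_def by (intro prod_zero) auto
    with False show ?thesis by simp
  qed (simp add: monomial_value_def)
  then have "psubst (\<lambda>_. 0) P = (\<Sum>m\<in>insert 0 (Poly_Mapping.keys P). 
      if m = 0 then of_int (const_term P) else 0)"
    by (subst psubst_superset[of "insert 0 (Poly_Mapping.keys P)"])
      (auto simp only: const_term_def * intro!: sum.cong, auto)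
  also have "\<dots> = of_int (const_term P)"
    by (subst sum.delta) auto
  finally show ?thesis .
qed

lemma const_term_psubst_zero: "const_term P = c \<longleftrightarrow> psubst (\<lambda>_. 0) P = of_int c"
  by (simp add: psubst_zero)

lemma const_term_add: "const_term (P + Q) = const_term P + const_term Q"
  using psubst_zero[of P] psubst_zero[of Q] by (simp add: const_term_psubst_zero psubst_simps)

lemma const_term_diff: "const_term (P - Q) = const_term P - const_term Q"
  using psubst_zero[of P] psubst_zero[of Q] by (simp add: const_term_psubst_zero psubst_simps)

lemma const_term_mult: "const_term (P * Q) = const_term P * const_term Q"
  using psubst_zero[of P] psubst_zero[of Q] by (simp add: const_term_psubst_zero psubst_simps)

lemma const_term_of_int [simp]: "const_term (of_int c) = c"
  by (simp add: const_term_psubst_zero)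

lemma const_term_0 [simp]: "const_term 0 = 0"
  by (simp add: const_term_psubst_zero)

lemma const_term_1 [simp]: "const_term 1 = 1"
  by (simp add: const_term_psubst_zero)

lemma const_term_pvar [simp]: "const_term (pvar v) = 0"
  by (simp add: const_term_psubst_zero)

lemma const_term_sum: "const_term (sum g A) = (\<Sum>a\<in>A. const_term (g a))"
  by (induction A rule: infinite_finite_induct) (auto simp: const_term_add)

lemma pvar_eq_iff [simp]: "pvar v = pvar v' \<longleftrightarrow> v = v'"
proof
  assume *: "pvar v = pvar v'"
  have "psubst (\<lambda>u. if u = v then 1 else 0) (pvar v) = psubst (\<lambda>u. if u = v then 1 else 0) (pvar v')"
    by (simp only: *)
  then show "v = v'" by (simp split: if_splits)
qed auto

section \<open>Divided differences\<close>

lemma simple_transp_simps [simp]: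
  "simple_transp i i = Suc i" "simple_transp i (Suc i) = i"
  "j \<noteq> i \<Longrightarrow> j \<noteq> Suc i \<Longrightarrow> simple_transp i j = j"
  "simple_transp i (simple_transp i j) = j"
  "simple_transp i \<circ> simple_transp i = id"
  by (auto simp: simple_transp_def transpose_def)

definition rename_x :: "(nat \<Rightarrow> nat) \<Rightarrow> xypoly \<Rightarrow> xypoly" where
  "rename_x \<sigma> = psubst (subst_xy (\<lambda>k. px (\<sigma> k)) py)"

lemma swap_x_eq: "swap_x i = rename_x (simple_transp i)"
  by (simp add: swap_x_def rename_x_def)

lemma rename_x_simps [simp]:
  "rename_x \<sigma> (px k) = px (\<sigma> k)"
  "rename_x \<sigma> (py k) = py k"
  "rename_x \<sigma> (of_int c) = of_int c"
  "rename_x \<sigma> 0 = 0"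
  "rename_x \<sigma> 1 = 1"
  "rename_x \<sigma> (P + Q) = rename_x \<sigma> P + rename_x \<sigma> Q"
  "rename_x \<sigma> (P - Q) = rename_x \<sigma> P - rename_x \<sigma> Q"
  "rename_x \<sigma> (P * Q) = rename_x \<sigma> P * rename_x \<sigma> Q"
  "rename_x \<sigma> (- P) = - rename_x \<sigma> P"
  by (auto simp: rename_x_def psubst_simps)

lemma rename_x_rename_x: "rename_x \<sigma> (rename_x \<tau> P) = rename_x (\<sigma> \<circ> \<tau>) P"
  by (induction P rule: xypoly_induct) 
    (simp_all, metis comp_apply rename_x_simps(1,2) var.exhaust)

lemma rename_x_id [simp]: "rename_x id P = P"
  by (induction P rule: xypoly_induct)
     (simp_all, metis id_apply rename_x_simps(1,2) var.exhaust)

lemma swap_x_swap_x [simp]: "swap_x i (swap_x i P) = P"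
  by (simp add: swap_x_eq rename_x_rename_x)

lemma swap_x_simps [simp]:
  "swap_x i (px k) = px (simple_transp i k)"
  "swap_x i (py k) = py k"
  "swap_x i (of_int c) = of_int c"
  "swap_x i 0 = 0"
  "swap_x i 1 = 1"
  "swap_x i (P + Q) = swap_x i P + swap_x i Q"
  "swap_x i (P - Q) = swap_x i P - swap_x i Q"
  "swap_x i (P * Q) = swap_x i P * swap_x i Q"
  "swap_x i (- P) = - swap_x i P"
  by (auto simp: swap_x_eq)

lemma px_diff_nonzero: "px i - px (Suc i) \<noteq> 0"
  by simp

lemma px_diff_cancel: 
  "P * (px i - px (Suc i)) = Q * (px i - px (Suc i)) \<longleftrightarrow> P = Q"
  using px_diff_nonzero mult_cancel_right by blast

lemma swap_x_difference_divisible: "\<exists>Q. Q * (px i - px (Suc i)) = P - swap_x i P"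
proof (induction P rule: xypoly_induct)
  case (const c)
  show ?case by (rule exI[of _ 0]) simp
next
  case (var v)
  show ?case
  proof (cases v)
    case (VX k)
    consider "k = i" | "k = Suc i" | "k \<noteq> i" "k \<noteq> Suc i" by auto
    then show ?thesis
    proof cases
      case 1
      then show ?thesis by (intro exI[of _ 1]) (simp add: VX)
    next
      case 2
      then show ?thesis by (intro exI[of _ "-1"]) (simp add: VX)
    next
      case 3
      then show ?thesis by (intro exI[of _ 0]) (simp add: VX)
    qed
  qed (auto intro: exI[of _ 0])
next
  case (add A B)
  then obtain Q R where "Q * (px i - px (Suc i)) = A - swap_x i A" "R * (px i - px (Suc i)) = B - swap_x i B"
    by blast
  then show ?case by (intro exI[of _ "Q + R"]) (simp add: algebra_simps)
next
  case (mult A B)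
  then obtain Q R where QR: "Q * (px i - px (Suc i)) = A - swap_x i A" "R * (px i - px (Suc i)) = B - swap_x i B"
    by blast
  have "(Q * B + swap_x i A * R) * (px i - px (Suc i)) = 
    (Q * (px i - px (Suc i))) * B + swap_x i A * (R * (px i - px (Suc i)))"
    by (simp only: algebra_simps)
  also have "\<dots> = A * B - swap_x i (A * B)"
    by (simp only: QR) (simp add: algebra_simps)
  finally show ?case by blast
qed

abbreviation dd :: "nat \<Rightarrow> xypoly \<Rightarrow> xypoly" where "dd \<equiv> divided_difference"

lemma divided_difference_unique:
  "Q * (px i - px (Suc i)) = P - swap_x i P \<Longrightarrow> dd i P = Q"
  unfolding divided_difference_def
  by (rule the_equality) (simp, metis Suc_eq_plus1 px_diff_cancel)

lemma divided_difference_mult: "dd i P * (px i - px (Suc i)) = P - swap_x i P"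
  using swap_x_difference_divisible[of i P] divided_difference_unique by metis

lemma dd_add: "dd i (P + Q) = dd i P + dd i Q"
  by (rule divided_difference_unique) (simp add: distrib_right divided_difference_mult)

lemma dd_diff: "dd i (P - Q) = dd i P - dd i Q"
  by (rule divided_difference_unique) (simp add: left_diff_distrib divided_difference_mult)

lemma dd_leibniz: "dd i (P * Q) = dd i P * Q + swap_x i P * dd i Q"
proof (rule divided_difference_unique)
  have "(dd i P * Q + swap_x i P * dd i Q) * (px i - px (Suc i)) =
    (dd i P * (px i - px (Suc i))) * Q + swap_x i P * (dd i Q * (px i - px (Suc i)))"
    by (simp only: algebra_simps)
  also have "\<dots> = P * Q - swap_x i (P * Q)"
    by (simp only: divided_difference_mult) (simp add: algebra_simps)
  finally show "(dd i P * Q + swap_x i P * dd i Q) * (px i - px (Suc i)) = P * Q - swap_x i (P * Q)" .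
qed

lemma dd_eq_0_iff: "dd i P = 0 \<longleftrightarrow> swap_x i P = P"
  using divided_difference_mult[of i P] px_diff_nonzero[of i]
  by (metis divided_difference_unique eq_iff_diff_eq_0 mult_zero_left)

lemma dd_of_int [simp]: "dd i (of_int c) = 0"
  by (simp add: dd_eq_0_iff)

lemma dd_0 [simp]: "dd i 0 = 0"
  by (simp add: dd_eq_0_iff)

lemma dd_1 [simp]: "dd i 1 = 0"
  by (simp add: dd_eq_0_iff)

lemma dd_symmetric_mult: "dd i P = 0 \<Longrightarrow> dd i (P * Q) = P * dd i Q"
  by (simp add: dd_leibniz dd_eq_0_iff)

lemma swap_x_dd: "swap_x i (dd i P) = dd i P"
proof -
  have "swap_x i (dd i P * (px i - px (Suc i))) = swap_x i (P - swap_x i P)"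
    by (simp only: divided_difference_mult)
  moreover have "swap_x i (P - swap_x i P) = - (dd i P * (px i - px (Suc i)))"
    unfolding divided_difference_mult by simp
  moreover have "swap_x i (dd i P * (px i - px (Suc i))) = - swap_x i (dd i P) * (px i - px (Suc i))"
    by (simp add: algebra_simps)
  ultimately have "- swap_x i (dd i P) * (px i - px (Suc i)) = - (dd i P * (px i - px (Suc i)))"
    by argo
  then show ?thesis
    by (metis minus_mult_left px_diff_cancel neg_equal_iff_equal)
qed

lemma dd_dd [simp]: "dd i (dd i P) = 0"
  by (simp add: dd_eq_0_iff swap_x_dd)

lemma dd_px: "dd i (px k) = (if k = i then 1 else if k = Suc i then -1 else 0)"
  by (rule divided_difference_unique) auto

text \<open>The twisted Leibniz rule for a variable: the correction term at $m = i$ and $m = i + 1$ is the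
  source of the terms in the Chevalley formula further below.\<close>

lemma dd_px_mult:
  "dd i (px m * f) = px (simple_transp i m) * dd i f + (if m = i then f else if m = Suc i then - f else 0)"
  by (auto simp: dd_leibniz dd_px)

lemma swap_x_commute: 
  assumes "Suc i < j"
  shows "swap_x i (swap_x j P) = swap_x j (swap_x i P)"
proof -
  have "simple_transp i \<circ> simple_transp j = simple_transp j \<circ> simple_transp i"
    using assms by (auto simp: simple_transp_def transpose_def)
  then show ?thesis by (simp add: swap_x_eq rename_x_rename_x)
qed

lemma swap_x_braid:
  "swap_x i (swap_x (Suc i) (swap_x i P)) = swap_x (Suc i) (swap_x i (swap_x (Suc i) P))"
proof -
  have "simple_transp i \<circ> (simple_transp (Suc i) \<circ> simple_transp i) 
      = simple_transp (Suc i) \<circ> (simple_transp i \<circ> simple_transp (Suc i))"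
    by (auto simp: simple_transp_def transpose_def)
  then show ?thesis by (simp add: swap_x_eq rename_x_rename_x)
qed

lemma dd_commute_less:
  assumes "Suc i < j"
  shows "dd i (dd j P) = dd j (dd i P)"
proof (rule divided_difference_unique)
  let ?a = "px i - px (Suc i)" and ?b = "px j - px (Suc j)"
  have sw: "swap_x i ?b = ?b" "swap_x j ?a = ?a"
    using assms by auto
  have 1: "swap_x i (dd j P) * ?b = swap_x i P - swap_x j (swap_x i P)"
    using arg_cong[OF divided_difference_mult[of j P], of "swap_x i"] sw
    by (simp add: swap_x_commute[OF assms])
  have 2: "swap_x j (dd i P) * ?a = swap_x j P - swap_x j (swap_x i P)"
    using arg_cong[OF divided_difference_mult[of i P], of "swap_x j"] sw by simp
  have "(dd j (dd i P) * ?a) * ?b = (dd j (dd i P) * ?b) * ?a"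
    by (simp only: ac_simps)
  also have "\<dots> = dd i P * ?a - swap_x j (dd i P) * ?a"
    by (simp only: divided_difference_mult left_diff_distrib)
  also have "\<dots> = dd j P * ?b - swap_x i (dd j P) * ?b"
    unfolding 1 2 divided_difference_mult by simp
  finally show "dd j (dd i P) * ?a = dd j P - swap_x i (dd j P)"
    by (metis left_diff_distrib px_diff_cancel)
qed

lemma dd_commute:
  assumes "Suc i < j \<or> Suc j < i"
  shows "dd i (dd j P) = dd j (dd i P)"
  using assms dd_commute_less[of i j P] dd_commute_less[of j i P] by auto

text \<open>Both sides of the braid relation, multiplied by the Vandermonde product, are the
  alternating sum of \<open>P\<close> over the six permutations of the three variables.\<close>

lemma dd_braid: "dd i (dd (Suc i) (dd i P)) = dd (Suc i) (dd i (dd (Suc i) P))"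
proof -
  define s t where "s = swap_x i" and "t = swap_x (Suc i)"
  define a b c where "a = px i" and "b = px (Suc i)" and "c = px (Suc (Suc i))"
  define V where "V = (a - b) * (b - c) * (a - c)"
  have st [simp]: "s a = b" "s b = a" "s c = c" "t a = a" "t b = c" "t c = b"
    by (simp_all add: s_def t_def a_def b_def c_def)
  have hom [simp]: "s (A - B) = s A - s B" "s (A * B) = s A * s B" 
      "t (A - B) = t A - t B" "t (A * B) = t A * t B" "s (s A) = A" "t (t A) = A" for A B
    by (simp_all add: s_def t_def)
  have braid: "t (s (t P)) = s (t (s P))"
    by (simp add: s_def t_def swap_x_braid)
  have di: "dd i A * (a - b) = A - s A" for A
    by (simp add: a_def b_def s_def divided_difference_mult)
  have dj: "dd (Suc i) A * (b - c) = A - t A" for A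
    by (simp add: c_def b_def t_def divided_difference_mult)
  define W where "W = P - s P - t P + t (s P) + s (t P) - s (t (s P))"
  have "V \<noteq> 0"
    by (simp add: V_def a_def b_def c_def)
  have 1: "dd i (dd (Suc i) (dd i P)) * V = W"
  proof -
    define Q R where "Q = dd i P" and "R = dd (Suc i) Q"
    have Q: "Q * (a - b) = P - s P" using di Q_def by simp
    have R: "R * (b - c) = Q - t Q" using dj R_def by simp
    have tQ: "t Q * (a - c) = t P - t (s P)" using arg_cong[OF Q, of t] by simp
    have RV: "R * V = (P - s P) * (a - c) - (t P - t (s P)) * (a - b)"
    proof -
      have "R * V = (R * (b - c)) * (a - b) * (a - c)" by (simp add: V_def)
      also have "\<dots> = (Q * (a - b)) * (a - c) - (t Q * (a - c)) * (a - b)"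
        unfolding R by (simp add: algebra_simps)
      finally show ?thesis unfolding Q tQ .
    qed
    have sV: "s V = - V" unfolding V_def hom st by (simp add: algebra_simps)
    have "s R * V = - s (R * V)" using sV by simp
    then have sRV: "s R * V = - ((s P - P) * (b - c) - (s (t P) - s (t (s P))) * (b - a))"
      unfolding RV by simp
    have "dd i R * V * (a - b) = (dd i R * (a - b)) * V" by (simp add: algebra_simps)
    also have "\<dots> = R * V - s R * V" unfolding di by (simp add: algebra_simps)
    also have "\<dots> = W * (a - b)" unfolding RV sRV W_def by (simp add: algebra_simps)
    finally show ?thesis unfolding R_def Q_def a_def b_def px_diff_cancel .
  qed
  have 2: "dd (Suc i) (dd i (dd (Suc i) P)) * V = W"
  proof -
    define Q R where "Q = dd (Suc i) P" and "R = dd i Q"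
    have Q: "Q * (b - c) = P - t P" using dj Q_def by simp
    have R: "R * (a - b) = Q - s Q" using di R_def by simp
    have sQ: "s Q * (a - c) = s P - s (t P)" using arg_cong[OF Q, of s] by simp
    have RV: "R * V = (P - t P) * (a - c) - (s P - s (t P)) * (b - c)"
    proof -
      have "R * V = (R * (a - b)) * (b - c) * (a - c)" by (simp add: V_def)
      also have "\<dots> = (Q * (b - c)) * (a - c) - (s Q * (a - c)) * (b - c)"
        unfolding R by (simp add: algebra_simps)
      finally show ?thesis unfolding Q sQ .
    qed
    have tV: "t V = - V" unfolding V_def hom st by (simp add: algebra_simps)
    have "t R * V = - t (R * V)" using tV by simp
    then have tRV: "t R * V = - ((t P - P) * (a - b) - (t (s P) - s (t (s P))) * (c - b))"
      unfolding RV by (simp add: braid)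
    have "dd (Suc i) R * V * (b - c) = (dd (Suc i) R * (b - c)) * V" by (simp add: algebra_simps)
    also have "\<dots> = R * V - t R * V" unfolding dj by (simp add: algebra_simps)
    also have "\<dots> = W * (b - c)" unfolding RV tRV W_def by (simp add: algebra_simps)
    finally show ?thesis unfolding R_def Q_def b_def c_def px_diff_cancel .
  qed
  from 1 2 \<open>V \<noteq> 0\<close> show ?thesis by (metis mult_cancel_right)
qed

text \<open>Divided differences commute, up to a factor, with setting the $y_j$ to 0, with discarding
  variables and with doubling all variables; these are the three uses of the next lemma.\<close>

lemma dd_psubst:
  assumes "\<And>v. swap_x i (f v) = psubst f (swap_x i (pvar v))"
    and "f (VX i) - f (VX (Suc i)) = c * (px i - px (Suc i))"
  shows "c * psubst f (dd i P) = dd i (psubst f P)"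
proof (rule divided_difference_unique[symmetric])
  have *: "swap_x i (psubst f P) = psubst f (swap_x i P)"
    by (induction P rule: xypoly_induct) (auto simp: assms(1) psubst_simps)
  have "psubst f (dd i P * (px i - px (Suc i))) = psubst f (P - swap_x i P)"
    by (simp only: divided_difference_mult)
  then show "c * psubst f (dd i P) * (px i - px (Suc i)) = psubst f P - swap_x i (psubst f P)"
    by (simp add: psubst_simps * assms(2) ac_simps)
qed

section \<open>Lengths of permutations\<close>

lemma permutes_S_inf: "w permutes {1..n} \<Longrightarrow> w \<in> S_inf"
  by (auto simp: S_inf_def)

lemma permutes_mono: "w permutes {1..n} \<Longrightarrow> n \<le> m \<Longrightarrow> w permutes {1..m::nat}"
  by (rule permutes_subset) auto

lemma simple_transp_permutes: "1 \<le> i \<Longrightarrow> i < n \<Longrightarrow> simple_transp i permutes {1..n}"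
  unfolding simple_transp_def by (rule permutes_swap_id) auto

lemma comp_simple_transp_permutes:
  "w permutes {1..n} \<Longrightarrow> 1 \<le> i \<Longrightarrow> i < n \<Longrightarrow> (w \<circ> simple_transp i) permutes {1..n}"
  by (rule permutes_compose[OF simple_transp_permutes])

lemma comp_transpose_permutes:
  "w permutes {1..n} \<Longrightarrow> a \<in> {1..n} \<Longrightarrow> b \<in> {1..n} \<Longrightarrow> (w \<circ> transpose a b) permutes {1..n}"
  by (rule permutes_compose[OF permutes_swap_id])

lemma comp_simple_transp_S_inf [simp]:
  assumes "w \<in> S_inf" "1 \<le> i"
  shows "w \<circ> simple_transp i \<in> S_inf"
proof -
  obtain n where "w permutes {1..n}" using assms by (auto simp: S_inf_def)
  then have "w permutes {1..n + i + 1}" by (rule permutes_mono) simp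
  then have "(w \<circ> simple_transp i) permutes {1..n + i + 1}"
    by (rule comp_simple_transp_permutes) (use assms in auto)
  then show ?thesis by (rule permutes_S_inf)
qed

lemma comp_simple_transp_cancel [simp]: "w \<circ> simple_transp i \<circ> simple_transp i = w"
  by (simp add: comp_assoc)

lemma S_inf_inj: "w \<in> S_inf \<Longrightarrow> inj w"
  by (auto simp: S_inf_def permutes_inj)

lemma S_inf_eq_iff: "w \<in> S_inf \<Longrightarrow> w i = w j \<longleftrightarrow> i = j"
  using S_inf_inj inj_eq by metis

lemma S_inf_0: "w \<in> S_inf \<Longrightarrow> w 0 = 0"
  by (auto simp: S_inf_def permutes_def)

lemma id_S_inf [simp]: "id \<in> S_inf"
  by (rule permutes_S_inf[of _ 0]) simp

lemma finite_inversion_set: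
  assumes "w \<in> S_inf"
  shows "finite {(i, j). i < j \<and> w j < w i}"
proof -
  obtain n where n: "w permutes {1..n}" using assms by (auto simp: S_inf_def)
  have "{(i, j). i < j \<and> w j < w i} \<subseteq> {0..n} \<times> {0..n}"
  proof (clarsimp)
    fix i j assume ij: "i < j" "w j < w i"
    have "j \<le> n"
    proof (rule ccontr)
      assume "\<not> j \<le> n"
      then have "w j = j" using permutes_not_in[OF n, of j] by auto
      moreover have "w i < j"
        using \<open>\<not> j \<le> n\<close> permutes_in_image[OF n, of i] permutes_not_in[OF n, of i] ij
        by (cases "i \<in> {1..n}") auto
      ultimately show False using ij by simp
    qed
    then show "i \<le> n \<and> j \<le> n" using ij by simp
  qed
  then show ?thesis by (rule finite_subset) simp
qed

lemma inversions_id [simp]: "inversions id = 0"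
proof -
  have "{(i, j). i < j \<and> id j < id (i::nat)} = {}" by auto
  then show ?thesis by (simp only: inversions_def card.empty)
qed

lemma inversions_ascent:
  assumes "w \<in> S_inf" "w i < w (Suc i)"
  shows "inversions (w \<circ> simple_transp i) = Suc (inversions w)"
proof -
  let ?s = "simple_transp i"
  let ?I = "{(a, b). a < b \<and> w b < w a}"
  let ?f = "\<lambda>(a, b). (?s a, ?s b)"
  have inj: "inj_on ?f ?I"
    by (rule inj_on_inverseI[of _ ?f]) auto
  have mono: "?s a < ?s b" if "a < b" "(a, b) \<noteq> (i, Suc i)" for a b
    using that by (auto simp: simple_transp_def transpose_def)
  have "{(a, b). a < b \<and> (w \<circ> ?s) b < (w \<circ> ?s) a} = insert (i, Suc i) (?f ` ?I)"
  proof (intro set_eqI iffI)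
    fix p assume p: "p \<in> {(a, b). a < b \<and> (w \<circ> ?s) b < (w \<circ> ?s) a}"
    show "p \<in> insert (i, Suc i) (?f ` ?I)"
    proof (cases "p = (i, Suc i)")
      case False
      then have "?f p \<in> ?I" using p mono by (cases p) auto
      moreover have "p = ?f (?f p)" by (cases p) auto
      ultimately have "p \<in> ?f ` ?I" by (rule rev_image_eqI)
      then show ?thesis by (rule insertI2)
    qed auto
  next
    fix p assume "p \<in> insert (i, Suc i) (?f ` ?I)"
    then show "p \<in> {(a, b). a < b \<and> (w \<circ> ?s) b < (w \<circ> ?s) a}"
    proof (elim insertE imageE)
      fix q assume q: "p = ?f q" "q \<in> ?I"
      then have "q \<noteq> (i, Suc i)" using assms(2) by auto
      then show ?thesis using q mono by (cases q) auto
    qed (use assms(2) in simp)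
  qed
  moreover have "(i, Suc i) \<notin> ?f ` ?I"
  proof
    assume "(i, Suc i) \<in> ?f ` ?I"
    then obtain a b where "a < b" "?s a = i" "?s b = Suc i" by auto
    moreover from this have "a = Suc i" "b = i" by (metis simple_transp_simps(1,2,4))+
    ultimately show False by simp
  qed
  ultimately show ?thesis
    using finite_inversion_set[OF assms(1)] inj
    by (simp only: inversions_def) (subst card_insert_disjoint, auto simp: card_image)
qed

lemma inversions_descent:
  assumes "w \<in> S_inf" "w (Suc i) < w i" "1 \<le> i"
  shows "inversions w = Suc (inversions (w \<circ> simple_transp i))"
  using inversions_ascent[of "w \<circ> simple_transp i" i] assms by simp

lemma inversions_simple_transp_less_iff:
  assumes "w \<in> S_inf" "1 \<le> i"
  shows "inversions (w \<circ> simple_transp i) < inversions w \<longleftrightarrow> w (Suc i) < w i"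
proof -
  have "w i \<noteq> w (Suc i)" using assms S_inf_eq_iff by simp
  then show ?thesis
    using inversions_ascent[of w i] inversions_descent[of w i] assms
    by (cases "w i < w (Suc i)") auto
qed

lemma descent_pos: "w \<in> S_inf \<Longrightarrow> w (Suc i) < w i \<Longrightarrow> 1 \<le> i"
  by (cases i) (auto simp: S_inf_0)

lemma transpose_conj_simple:
  assumes "Suc a < b"
  shows "w \<circ> transpose a b = w \<circ> simple_transp a \<circ> transpose (Suc a) b \<circ> simple_transp a"
  using assms by (auto simp: simple_transp_def transpose_def fun_eq_iff)

text \<open>The proof conjugates $(a\;b)$ to $(a{+}1\;b)$ by the simple transposition at \<open>a\<close>. Each conjugation step
  changes the length by one, and whatever the position of \<open>w (a + 1)\<close> relative to \<open>w a\<close> and \<open>w b\<close>,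
  the two steps cannot both go up.\<close>

lemma inversions_transpose_less:
  assumes "w \<in> S_inf" "1 \<le> a" "a < b" "w b < w a"
  shows "w \<circ> transpose a b \<in> S_inf \<and> inversions (w \<circ> transpose a b) < inversions w"
  using assms
proof (induction "b - a" arbitrary: a w)
  case (Suc d)
  show ?case
  proof (cases "b = Suc a")
    case True
    then have "transpose a b = simple_transp a" by (simp add: simple_transp_def)
    then show ?thesis using Suc.prems True inversions_descent[of w a] by simp
  next
    case False
    let ?s = "simple_transp a"
    let ?v = "w \<circ> ?s" and ?u = "w \<circ> ?s \<circ> transpose (Suc a) b"
    have b: "Suc a < b" using False Suc.prems by simp
    have vb: "?v b = w b" "?v (Suc a) = w a" "?v a = w (Suc a)" using b by auto
    have ub: "?u a = w (Suc a)" "?u (Suc a) = w b" using b by (auto simp: transpose_def)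
    have v: "?v \<in> S_inf" using Suc.prems by simp
    have u: "?u \<in> S_inf \<and> inversions ?u < inversions ?v"
      by (rule Suc.hyps(1)) (use Suc.hyps(2) Suc.prems b v vb in auto)
    have eq: "w \<circ> transpose a b = ?u \<circ> ?s"
      by (rule transpose_conj_simple[OF b])
    have ne: "w a \<noteq> w (Suc a)" "w b \<noteq> w (Suc a)"
      using b S_inf_eq_iff[OF Suc.prems(1)] by auto
    have "inversions (?u \<circ> ?s) < inversions w"
    proof (cases "w (Suc a) < w b")
      case True
      then have "inversions (?u \<circ> ?s) = Suc (inversions ?u)"
        using inversions_ascent[of ?u a] u ub by (metis)
      moreover have "inversions w = Suc (inversions ?v)"
        using inversions_descent[of w a] Suc.prems True by auto
      ultimately show ?thesis using u by simp
    next
      case False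
      then have 1: "inversions ?u = Suc (inversions (?u \<circ> ?s))"
        using inversions_descent[of ?u a] u ub ne Suc.prems by (metis linorder_neqE_nat)
      have "inversions ?v \<le> Suc (inversions w)"
        using inversions_descent[of w a] inversions_ascent[of w a] Suc.prems ne
        by (cases "w a < w (Suc a)") auto
      then show ?thesis using 1 u by linarith
    qed
    moreover have "?u \<circ> ?s \<in> S_inf" using u Suc.prems by simp
    ultimately show ?thesis unfolding eq by simp
  qed
qed simp

lemma inversions_transpose_less_iff:
  assumes "w \<in> S_inf" "1 \<le> a" "a < b"
  shows "inversions (w \<circ> transpose a b) < inversions w \<longleftrightarrow> w b < w a"
proof
  assume *: "inversions (w \<circ> transpose a b) < inversions w"
  show "w b < w a"
  proof (rule ccontr)
    assume "\<not> w b < w a"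
    moreover have "w a \<noteq> w b" using assms S_inf_eq_iff[OF assms(1)] by auto
    ultimately have lt: "w a < w b" by simp
    obtain n where "w permutes {1..n}" using assms by (auto simp: S_inf_def)
    then have "w permutes {1..n + b}" by (rule permutes_mono) simp
    then have "(w \<circ> transpose a b) permutes {1..n + b}"
      by (rule comp_transpose_permutes) (use assms in auto)
    then have "w \<circ> transpose a b \<in> S_inf" by (rule permutes_S_inf)
    from inversions_transpose_less[OF this assms(2,3)] lt
    have "inversions (w \<circ> transpose a b \<circ> transpose a b) < inversions (w \<circ> transpose a b)" by simp
    then show False using * by (simp add: comp_assoc)
  qed
qed (use inversions_transpose_less assms in blast)

lemma transpose_conj:
  fixes a b c :: nat
  assumes "a < c" "c < b"
  shows "w \<circ> transpose a b = w \<circ> transpose a c \<circ> transpose c b \<circ> transpose a c"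
  using assms by (intro ext) (auto simp: transpose_def)

text \<open>A transposition that skips over an intermediate value lowers the length by at least three,
  being the product of three length-decreasing transpositions.\<close>

lemma inversions_cover_no_between:
  assumes "w \<in> S_inf" "1 \<le> a" "a < c" "c < b" "w b < w c" "w c < w a"
  shows "inversions (w \<circ> transpose a b) + 3 \<le> inversions w"
proof -
  let ?w1 = "w \<circ> transpose a c"
  let ?w2 = "?w1 \<circ> transpose c b"
  have 1: "?w1 \<in> S_inf \<and> inversions ?w1 < inversions w"
    by (rule inversions_transpose_less) (use assms in auto)
  have 2: "?w2 \<in> S_inf \<and> inversions ?w2 < inversions ?w1"
    by (rule inversions_transpose_less) (use assms 1 in \<open>auto simp: transpose_def\<close>)
  have "?w2 \<circ> transpose a c \<in> S_inf \<and> inversions (?w2 \<circ> transpose a c) < inversions ?w2"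
    by (rule inversions_transpose_less) (use assms 2 in \<open>auto simp: transpose_def\<close>)
  then show ?thesis using 1 2 transpose_conj[OF assms(3,4), of w] by simp
qed

text \<open>If \<open>w t\<close> is covered by \<open>w\<close> then a descent of \<open>w\<close> remains a descent of \<open>w t\<close>, unless \<open>t\<close> is
  the simple transposition at that descent: otherwise a value in between would be skipped.\<close>

lemma cover_keeps_descent:
  assumes "w \<in> S_inf" "1 \<le> a" "a < b" "inversions (w \<circ> transpose a b) + 1 = inversions w"
    and "w (Suc i) < w i" "(a, b) \<noteq> (i, Suc i)"
  shows "(w \<circ> transpose a b) (Suc i) < (w \<circ> transpose a b) i"
proof -
  have ba: "w b < w a"
    using inversions_transpose_less_iff[OF assms(1-3)] assms(4) by simp
  have nb: "\<not> (w b < w c \<and> w c < w a)" if "a < c" "c < b" for c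
    using inversions_cover_no_between[OF assms(1,2) that] assms(4) by auto
  consider "{i, Suc i} \<inter> {a, b} = {}" | "i = a" | "Suc i = a" | "i = b" | "Suc i = b" by blast
  then show ?thesis
  proof cases
    case 1
    then show ?thesis using assms(5) by (auto simp: transpose_def)
  next
    case 2
    then have "a < Suc i" "Suc i < b" using assms by auto
    moreover from this have "w (Suc i) \<noteq> w b" using S_inf_eq_iff[OF assms(1)] by simp
    ultimately show ?thesis using 2 nb[of "Suc i"] assms(5) by (auto simp: transpose_def)
  next
    case 3
    then show ?thesis using assms(3,5) ba by (auto simp: transpose_def)
  next
    case 4
    then show ?thesis using assms(3,5) ba by (auto simp: transpose_def)
  next
    case 5
    then have "a < i" "i < b" using assms by auto
    moreover from this have "w i \<noteq> w a" using S_inf_eq_iff[OF assms(1)] by simp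
    ultimately show ?thesis using 5 nb[of i] assms(5) by (auto simp: transpose_def)
  qed
qed

text \<open>A permutation without descents is strictly increasing, so \<open>w i \<ge> i\<close>; it fixes all large
  numbers, so \<open>w i \<le> i\<close>.\<close>

lemma no_descent_imp_id:
  assumes "w \<in> S_inf" "\<And>i. 1 \<le> i \<Longrightarrow> w i < w (Suc i)"
  shows "w = id"
proof -
  obtain n where n: "w permutes {1..n}" using assms by (auto simp: S_inf_def)
  have "w (Suc 0) \<noteq> w 0" using S_inf_eq_iff[OF assms(1)] by simp
  then have "w 0 < w (Suc 0)" using S_inf_0[OF assms(1)] by simp
  then have step: "w i < w (Suc i)" for i
    using assms(2)[of i] by (cases "i = 0") auto
  have mono: "strict_mono w" using step by (rule iffD2[OF strict_mono_Suc_iff, rule_format])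
  have "w i \<le> i" for i
  proof -
    have "w i + k \<le> w (i + k)" for k
      by (induction k) (use step in \<open>auto simp: Suc_le_eq intro: le_less_trans\<close>)
    moreover have "w (i + Suc n) = i + Suc n" using permutes_not_in[OF n] by auto
    ultimately show ?thesis by (metis add_le_cancel_right)
  qed
  moreover have "i \<le> w i" for i using mono by (rule strict_mono_imp_increasing)
  ultimately show ?thesis by (auto simp: fun_eq_iff intro: le_antisym)
qed

lemma descent_exists:
  assumes "w \<in> S_inf" "w \<noteq> id"
  obtains i where "1 \<le> i" "w (Suc i) < w i"
proof -
  have "w i < w (Suc i) \<or> w (Suc i) < w i" for i
    using S_inf_eq_iff[OF assms(1), of i "Suc i"] linorder_neqE_nat[of "w i" "w (Suc i)"] by auto
  then show ?thesis using no_descent_imp_id[OF assms(1)] assms(2) that by blast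
qed

lemma inversions_eq_0_iff: "w \<in> S_inf \<Longrightarrow> inversions w = 0 \<longleftrightarrow> w = id"
  by (metis Zero_not_Suc descent_exists inversions_descent inversions_id)

lemma descent_bound:
  assumes "w permutes {1..n}" "w (Suc i) < w i"
  shows "i < n"
proof (rule ccontr)
  assume "\<not> i < n"
  then have "w (Suc i) = Suc i" using permutes_not_in[OF assms(1), of "Suc i"] by auto
  moreover have "w i \<le> i"
    using \<open>\<not> i < n\<close> permutes_in_image[OF assms(1), of i] permutes_not_in[OF assms(1), of i]
    by (cases "i \<in> {1..n}") auto
  ultimately show False using assms(2) by simp
qed

lemma S_inf_descent_induct [consumes 1, case_names id descent]:
  assumes "w \<in> S_inf" "Q id"
    and "\<And>w i. w \<in> S_inf \<Longrightarrow> 1 \<le> i \<Longrightarrow> w (Suc i) < w i \<Longrightarrow> Q (w \<circ> simple_transp i) \<Longrightarrow> Q w"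
  shows "Q w"
  using assms(1)
proof (induction "inversions w" arbitrary: w rule: less_induct)
  case less
  show ?case
  proof (cases "w = id")
    case False
    then obtain i where i: "1 \<le> i" "w (Suc i) < w i"
      using descent_exists less.prems by blast
    then have "Q (w \<circ> simple_transp i)"
      using less.prems inversions_descent[of w i] by (intro less.hyps) auto
    then show ?thesis using assms(3) less.prems i by blast
  qed (use assms in simp)
qed

section \<open>Recursion along descents\<close>

text \<open>If operators \<open>A i\<close> satisfy the commutation and braid relations, then applying them along the
  descents of \<open>w\<close> does not depend on which descents are chosen. The recursion below picks the
  first descent; it stops after \<open>inversions w\<close> steps.\<close>

primrec along_descents_aux :: "(nat \<Rightarrow> 'a \<Rightarrow> 'a) \<Rightarrow> 'a \<Rightarrow> nat \<Rightarrow> (nat \<Rightarrow> nat) \<Rightarrow> 'a" where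
  "along_descents_aux A x 0 w = x"
| "along_descents_aux A x (Suc l) w = (let i = LEAST i. w (Suc i) < w i in
     A i (along_descents_aux A x l (w \<circ> simple_transp i)))"

definition along_descents :: "(nat \<Rightarrow> 'a \<Rightarrow> 'a) \<Rightarrow> 'a \<Rightarrow> (nat \<Rightarrow> nat) \<Rightarrow> 'a" where
  "along_descents A x w = along_descents_aux A x (inversions w) w"

lemma along_descents_id [simp]: "along_descents A x id = x"
  by (simp add: along_descents_def)

text \<open>Two descents \<open>i\<close>, \<open>j\<close> of \<open>w\<close> are compared through a common permutation below \<open>w s\<^sub>i\<close> and
  \<open>w s\<^sub>j\<close>: it is \<open>w s\<^sub>i s\<^sub>j\<close> for distant \<open>i\<close>, \<open>j\<close> and \<open>w s\<^sub>i s\<^sub>j s\<^sub>i\<close> for neighbours, as \<open>w\<close> then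
  decreases at three consecutive places.\<close>

lemma along_descents_step:
  fixes A :: "nat \<Rightarrow> 'a \<Rightarrow> 'a"
  assumes comm: "\<And>i j y. Suc i < j \<Longrightarrow> A i (A j y) = A j (A i y)"
    and braid: "\<And>i y. A i (A (Suc i) (A i y)) = A (Suc i) (A i (A (Suc i) y))"
    and "w \<in> S_inf" "w (Suc i) < w i"
  shows "along_descents A x w = A i (along_descents A x (w \<circ> simple_transp i))"
  using assms(3,4)
proof (induction "inversions w" arbitrary: w i rule: less_induct)
  case less
  define i0 where "i0 = (LEAST i. w (Suc i) < w i)"
  have i0: "w (Suc i0) < w i0" unfolding i0_def by (rule LeastI) (rule less.prems(2))
  have pos: "1 \<le> j" if "w (Suc j) < w j" for j using descent_pos less.prems(1) that by blast
  have len: "inversions w = Suc (inversions (w \<circ> simple_transp j))" if "w (Suc j) < w j" for j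
    using inversions_descent[OF less.prems(1) that pos[OF that]] .
  have first: "along_descents A x w = A i0 (along_descents A x (w \<circ> simple_transp i0))"
    unfolding along_descents_def len[OF i0] by (simp add: i0_def[symmetric] Let_def)
  have IH: "along_descents A x v = A j (along_descents A x (v \<circ> simple_transp j))"
    if "v \<in> S_inf" "inversions v < inversions w" "v (Suc j) < v j" for v j
    using less.hyps that by blast
  have one: "A i (along_descents A x (w \<circ> simple_transp i)) 
      = A j (along_descents A x (w \<circ> simple_transp j))"
    if i: "w (Suc i) < w i" and j: "w (Suc j) < w j" and "i < j" for i j
  proof -
    have S: "w \<circ> simple_transp i \<in> S_inf" "w \<circ> simple_transp j \<in> S_inf"
      using less.prems(1) pos i j by auto
    show ?thesis
    proof (cases "j = Suc i")
      case False
      then have ij: "Suc i < j" using \<open>i < j\<close> by simp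
      have eq: "w \<circ> simple_transp i \<circ> simple_transp j = w \<circ> simple_transp j \<circ> simple_transp i"
        using ij by (auto simp: simple_transp_def transpose_def fun_eq_iff)
      have "along_descents A x (w \<circ> simple_transp i) 
          = A j (along_descents A x (w \<circ> simple_transp i \<circ> simple_transp j))"
        by (rule IH) (use S len[OF i] ij j in auto)
      moreover have "along_descents A x (w \<circ> simple_transp j) 
          = A i (along_descents A x (w \<circ> simple_transp j \<circ> simple_transp i))"
        by (rule IH) (use S len[OF j] ij i in auto)
      ultimately show ?thesis using comm[OF ij] eq by simp
    next
      case True
      let ?s = "simple_transp i" and ?t = "simple_transp (Suc i)"
      have desc: "w (Suc (Suc i)) < w (Suc i)" "w (Suc i) < w i" using i j True by auto
      have eq: "w \<circ> ?s \<circ> ?t \<circ> ?s = w \<circ> ?t \<circ> ?s \<circ> ?t"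
        by (auto simp: simple_transp_def transpose_def fun_eq_iff)
      have S': "w \<circ> ?s \<circ> ?t \<in> S_inf" "w \<circ> ?t \<circ> ?s \<in> S_inf" using S True pos[OF i] by auto
      have l: "inversions (w \<circ> ?s) < inversions w" "inversions (w \<circ> ?t) < inversions w" 
        using len[OF i] len[OF j] True by auto
      have l': "inversions (w \<circ> ?s \<circ> ?t) < inversions (w \<circ> ?s)" 
        by (subst inversions_simple_transp_less_iff) (use S desc in auto)
      have l'': "inversions (w \<circ> ?t \<circ> ?s) < inversions (w \<circ> ?t)"
        by (subst inversions_simple_transp_less_iff) (use S desc True pos[OF i] in auto)
      have "along_descents A x (w \<circ> ?s) = A (Suc i) (along_descents A x (w \<circ> ?s \<circ> ?t))"
        by (rule IH) (use S l desc in auto)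
      also have "along_descents A x (w \<circ> ?s \<circ> ?t) = A i (along_descents A x (w \<circ> ?s \<circ> ?t \<circ> ?s))"
        by (rule IH) (use S' l l' desc in auto)
      finally have 1: "along_descents A x (w \<circ> ?s) = A (Suc i) (A i (along_descents A x (w \<circ> ?s \<circ> ?t \<circ> ?s)))" .
      have "along_descents A x (w \<circ> ?t) = A i (along_descents A x (w \<circ> ?t \<circ> ?s))"
        by (rule IH) (use S True l desc in auto)
      also have "along_descents A x (w \<circ> ?t \<circ> ?s) = A (Suc i) (along_descents A x (w \<circ> ?t \<circ> ?s \<circ> ?t))"
        by (rule IH) (use S' l l'' desc in auto)
      finally have 2: "along_descents A x (w \<circ> ?t) = A i (A (Suc i) (along_descents A x (w \<circ> ?t \<circ> ?s \<circ> ?t)))" .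
      show ?thesis unfolding True 1 2 eq by (rule braid)
    qed
  qed
  show ?case
    using first one[OF i0 less.prems(2)] one[OF less.prems(2) i0] by (metis linorder_neqE_nat)
qed

section \<open>Existence and uniqueness of double Schubert polynomials\<close>

lemma longest_perm_permutes: "longest_perm n permutes {1..n}"
proof (rule bij_imp_permutes)
  show "bij_betw (longest_perm n) {1..n} {1..n}"
    by (rule bij_betw_byWitness[of _ "longest_perm n"]) (auto simp: longest_perm_def)
qed (auto simp: longest_perm_def)

lemma longest_perm_invol [simp]: "longest_perm n (longest_perm n i) = i"
  by (auto simp: longest_perm_def)

lemma longest_perm_comp_invol [simp]: "longest_perm n \<circ> longest_perm n = id"
  by (auto simp: fun_eq_iff)

lemma longest_perm_0: "longest_perm 0 = id"
  by (auto simp: longest_perm_def fun_eq_iff)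

lemma longest_perm_comp_descent:
  assumes "w permutes {1..n}" "1 \<le> i" "i < n"
  shows "(longest_perm n \<circ> w) (Suc i) < (longest_perm n \<circ> w) i \<longleftrightarrow> w i < w (Suc i)"
proof -
  have "w i \<in> {1..n}" "w (Suc i) \<in> {1..n}"
    using permutes_in_image[OF assms(1)] assms by auto
  then show ?thesis by (auto simp: longest_perm_def)
qed

lemma longest_perm_comp_permutes:
  "w permutes {1..n} \<Longrightarrow> (longest_perm n \<circ> w) permutes {1..n}"
  by (rule permutes_compose[OF _ longest_perm_permutes])

lemma ascent_exists:
  assumes "w permutes {1..n}" "w \<noteq> longest_perm n"
  obtains i where "1 \<le> i" "i < n" "w i < w (Suc i)"
proof -
  let ?u = "longest_perm n \<circ> w"
  have "?u \<noteq> id"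
  proof
    assume "?u = id"
    then have "longest_perm n \<circ> ?u = longest_perm n" by simp
    then have "w = longest_perm n" by (simp flip: comp_assoc)
    then show False using assms by simp
  qed
  moreover have u: "?u permutes {1..n}" using assms by (intro longest_perm_comp_permutes)
  ultimately obtain i where i: "1 \<le> i" "?u (Suc i) < ?u i"
    using descent_exists permutes_S_inf by blast
  then have "i < n" using descent_bound[OF u] by blast
  with i longest_perm_comp_descent[OF assms(1)] that show ?thesis by blast
qed

text \<open>Descending from $w_0$: every other element of $S_n$ has an ascent \<open>i < n\<close>, and \<open>w s\<^sub>i\<close> is closer
  to $w_0$.\<close>

lemma permutes_ascent_induct [consumes 1, case_names step]:
  assumes "w permutes {1..n}"
    and "\<And>w. w permutes {1..n} \<Longrightarrow>
      (\<And>i. 1 \<le> i \<Longrightarrow> i < n \<Longrightarrow> w i < w (Suc i) \<Longrightarrow> Q (w \<circ> simple_transp i)) \<Longrightarrow> Q w"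
  shows "Q w"
  using assms(1)
proof (induction "inversions (longest_perm n \<circ> w)" arbitrary: w rule: less_induct)
  case less
  show ?case
  proof (rule assms(2)[OF less.prems])
    fix i assume i: "1 \<le> i" "i < n" "w i < w (Suc i)"
    let ?u = "longest_perm n \<circ> w"
    have "?u \<in> S_inf" using longest_perm_comp_permutes[OF less.prems] by (rule permutes_S_inf)
    then have "inversions ?u = Suc (inversions (?u \<circ> simple_transp i))"
      using inversions_descent longest_perm_comp_descent[OF less.prems] i by blast
    then show "Q (w \<circ> simple_transp i)"
      using less.prems i
      by (intro less.hyps comp_simple_transp_permutes) (auto simp: comp_assoc)
  qed
qed

definition top_schubert :: "nat \<Rightarrow> xypoly" where
  "top_schubert n = (\<Prod>(i, j)\<in>{(i, j). 1 \<le> i \<and> 1 \<le> j \<and> i + j \<le> n}. px i - py j)"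

text \<open>Inside $S_n$ the descents of $w_0 w$ are the ascents of \<open>w\<close>. Recursion along the former
  therefore applies divided differences to the top polynomial while going down from $w_0$ to \<open>w\<close>.\<close>

definition schubert_in :: "nat \<Rightarrow> (nat \<Rightarrow> nat) \<Rightarrow> xypoly" where
  "schubert_in n w = along_descents dd (top_schubert n) (longest_perm n \<circ> w)"

lemma schubert_in_longest_perm: "schubert_in n (longest_perm n) = top_schubert n"
  by (simp add: schubert_in_def)

lemma schubert_in_ascent:
  assumes "w permutes {1..n}" "1 \<le> i" "i < n" "w i < w (Suc i)"
  shows "schubert_in n w = dd i (schubert_in n (w \<circ> simple_transp i))"
  unfolding schubert_in_def comp_assoc[symmetric]
proof (rule along_descents_step)
  show "longest_perm n \<circ> w \<in> S_inf"
    using longest_perm_comp_permutes[OF assms(1)] by (rule permutes_S_inf)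
qed (use dd_commute dd_braid longest_perm_comp_descent assms in auto)

definition lehmer_code :: "(nat \<Rightarrow> nat) \<Rightarrow> nat \<Rightarrow> nat" where
  "lehmer_code w i = card {j. i < j \<and> w j < w i}"

lemma finite_lehmer_code_set: "w \<in> S_inf \<Longrightarrow> finite {j. i < j \<and> w j < w i}"
  by (rule finite_subset[OF _ finite_vimageI[OF finite_lessThan[of "w i"] S_inf_inj]]) auto

lemma lehmer_code_ascent:
  assumes "w \<in> S_inf" "w i < w (Suc i)"
  shows "lehmer_code (w \<circ> simple_transp i) l =
    (if l = i then Suc (lehmer_code w (Suc i)) else if l = Suc i then lehmer_code w i else lehmer_code w l)"
proof -
  let ?s = "simple_transp i"
  consider "l = i" | "l = Suc i" | "l < i" | "Suc i < l" by linarith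
  then show ?thesis
  proof cases
    case 1
    have "{j. i < j \<and> (w \<circ> ?s) j < (w \<circ> ?s) i} = insert (Suc i) {j. Suc i < j \<and> w j < w (Suc i)}"
    proof (intro set_eqI)
      fix j show "j \<in> {j. i < j \<and> (w \<circ> ?s) j < (w \<circ> ?s) i} \<longleftrightarrow> 
          j \<in> insert (Suc i) {j. Suc i < j \<and> w j < w (Suc i)}"
        using assms(2) by (cases "j = Suc i"; cases "j \<le> i") auto
    qed
    then show ?thesis using finite_lehmer_code_set[OF assms(1)] 1 by (simp add: lehmer_code_def del: comp_apply)
  next
    case 2
    have "{j. Suc i < j \<and> (w \<circ> ?s) j < (w \<circ> ?s) (Suc i)} = {j. i < j \<and> w j < w i}"
    proof (intro set_eqI)
      fix j show "j \<in> {j. Suc i < j \<and> (w \<circ> ?s) j < (w \<circ> ?s) (Suc i)} \<longleftrightarrow> 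
          j \<in> {j. i < j \<and> w j < w i}"
        using assms(2) by (cases "j = Suc i"; cases "j \<le> i") auto
    qed
    then show ?thesis using 2 by (simp add: lehmer_code_def del: comp_apply)
  next
    case 3
    have "{j. l < j \<and> (w \<circ> ?s) j < (w \<circ> ?s) l} = ?s ` {j. l < j \<and> w j < w l}" (is "?A = ?s ` ?B")
    proof (intro set_eqI iffI)
      fix j assume "j \<in> ?A"
      then have "?s j \<in> ?B" using 3 by (auto simp: simple_transp_def transpose_def split: if_splits)
      then have "?s (?s j) \<in> ?s ` ?B" by (rule imageI)
      then show "j \<in> ?s ` ?B" by simp
    next
      fix j assume "j \<in> ?s ` ?B"
      then show "j \<in> ?A" using 3 by (auto simp: simple_transp_def transpose_def split: if_splits)
    qed
    moreover have "inj ?s" by (simp add: simple_transp_def)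
    ultimately show ?thesis using 3
      by (simp add: lehmer_code_def card_image inj_on_subset del: comp_apply)
  next
    case 4
    then have "{j. l < j \<and> (w \<circ> ?s) j < (w \<circ> ?s) l} = {j. l < j \<and> w j < w l}" by auto
    then show ?thesis using 4 by (simp add: lehmer_code_def del: comp_apply)
  qed
qed

lemma lehmer_code_le_ascent:
  assumes "w \<in> S_inf" "w i < w (Suc i)"
  shows "lehmer_code w i \<le> lehmer_code w (Suc i)"
  unfolding lehmer_code_def
proof (rule card_mono[OF finite_lehmer_code_set[OF assms(1)]])
  show "{j. i < j \<and> w j < w i} \<subseteq> {j. Suc i < j \<and> w j < w (Suc i)}"
    using assms(2) by (auto simp: Suc_lessI less_trans intro: Suc_lessI)
qed

lemma lehmer_code_less_descent:
  assumes "w \<in> S_inf" "w (Suc i) < w i"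
  shows "lehmer_code w (Suc i) < lehmer_code w i"
  unfolding lehmer_code_def
  by (rule psubset_card_mono[OF finite_lehmer_code_set[OF assms(1)]]) (use assms(2) in auto)

text \<open>The product of $x_i - y_j$ over the cells of the left-justified diagram whose rows are the code of \<open>w\<close>.
  For dominant permutations this is the double Schubert polynomial.\<close>

definition code_product :: "nat \<Rightarrow> (nat \<Rightarrow> nat) \<Rightarrow> xypoly" where
  "code_product n w = (\<Prod>i\<in>{1..n}. \<Prod>j\<in>{1..lehmer_code w i}. px i - py j)"

definition dominant :: "(nat \<Rightarrow> nat) \<Rightarrow> bool" where
  "dominant w \<longleftrightarrow> (\<forall>i\<ge>1. lehmer_code w (Suc i) \<le> lehmer_code w i)"

lemma lehmer_code_longest_perm:
  assumes "1 \<le> i"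
  shows "lehmer_code (longest_perm n) i = n - i"
proof -
  have "{j. i < j \<and> longest_perm n j < longest_perm n i} = {i<..n}"
    using assms by (auto simp: longest_perm_def split: if_splits)
  then show ?thesis by (simp add: lehmer_code_def)
qed

lemma dominant_longest_perm: "dominant (longest_perm n)"
  by (auto simp: dominant_def lehmer_code_longest_perm)

lemma code_product_longest_perm: "code_product n (longest_perm n) = top_schubert n"
proof -
  have "{(i, j). 1 \<le> i \<and> 1 \<le> j \<and> i + j \<le> n} = (SIGMA i:{1..n}. {1..lehmer_code (longest_perm n) i})"
    by (auto simp: lehmer_code_longest_perm)
  then show ?thesis
    unfolding code_product_def top_schubert_def by (simp add: prod.Sigma)
qed

lemma swap_x_prod: "swap_x i (prod g A) = (\<Prod>a\<in>A. swap_x i (g a))"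
  by (simp add: swap_x_def psubst_prod)

text \<open>At the first ascent \<open>i\<close> of a dominant permutation the code takes equal values at \<open>i\<close> and \<open>i + 1\<close>.
  Hence \<open>w s\<^sub>i\<close> is dominant and its product has just one more factor, which the divided
  difference removes.\<close>

lemma schubert_in_dominant:
  assumes "w permutes {1..n}" "dominant w"
  shows "schubert_in n w = code_product n w"
  using assms
proof (induction w rule: permutes_ascent_induct)
  case (step w)
  have S: "w \<in> S_inf" using step.hyps permutes_S_inf by blast
  show ?case
  proof (cases "w = longest_perm n")
    case True
    then show ?thesis by (simp add: schubert_in_longest_perm code_product_longest_perm)
  next
    case False
    define Q where "Q i \<longleftrightarrow> 1 \<le> i \<and> i < n \<and> w i < w (Suc i)" for i
    define i where "i = (LEAST i. Q i)"
    have ex: "\<exists>i. Q i" using ascent_exists[OF step.hyps False] unfolding Q_def by metis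
    then have "Q i" unfolding i_def by (rule LeastI_ex)
    then have i: "1 \<le> i" "i < n" "w i < w (Suc i)" by (auto simp: Q_def)
    have least: "\<not> Q l" if "l < i" for l using that not_less_Least unfolding i_def by blast
    let ?s = "simple_transp i"
    let ?v = "w \<circ> ?s"
    have eq: "lehmer_code w (Suc i) = lehmer_code w i"
      using lehmer_code_le_ascent[OF S i(3)] step.prems i(1) by (auto simp: dominant_def intro: le_antisym)
    have codev: "lehmer_code ?v l = (if l = i then Suc (lehmer_code w i) else lehmer_code w l)" for l
      using lehmer_code_ascent[OF S i(3), of l] eq by auto
    have "dominant ?v"
      unfolding dominant_def
    proof (intro allI impI)
      fix l :: nat assume l: "1 \<le> l"
      have "lehmer_code w i < lehmer_code w l" if "Suc l = i"
      proof -
        have "\<not> w l < w (Suc l)" using least[of l] that l i by (auto simp: Q_def)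
        then have "w (Suc l) < w l" using S_inf_eq_iff[OF S, of l "Suc l"] by simp
        then show ?thesis using lehmer_code_less_descent[OF S] that by blast
      qed
      then show "lehmer_code ?v (Suc l) \<le> lehmer_code ?v l"
        using step.prems l unfolding codev dominant_def by (auto intro: le_SucI)
    qed
    then have IH: "schubert_in n ?v = code_product n ?v"
      using step.IH[OF i] by blast
    have "code_product n ?v = 
        (\<Prod>j\<in>{1..Suc (lehmer_code w i)}. px i - py j) * (\<Prod>l\<in>{1..n} - {i}. \<Prod>j\<in>{1..lehmer_code w l}. px l - py j)"
      unfolding code_product_def using i by (subst prod.remove[of _ i]) (auto simp: codev)
    \<comment> \<open>Split off the single extra factor; the rest is symmetric in \<open>x\<^sub>i\<close> and \<open>x\<^sub>i\<^sub>+\<^sub>1\<close> as rows \<open>i\<close> and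
       \<open>i + 1\<close> of the diagram of \<open>w\<close> have equal length.\<close>
    also have "\<dots> = (px i - py (Suc (lehmer_code w i))) * ((\<Prod>j\<in>{1..lehmer_code w i}. px i - py j) * 
        (\<Prod>l\<in>{1..n} - {i}. \<Prod>j\<in>{1..lehmer_code w l}. px l - py j))"
      by (simp add: ac_simps)
    also have "(\<Prod>j\<in>{1..lehmer_code w i}. px i - py j) * 
        (\<Prod>l\<in>{1..n} - {i}. \<Prod>j\<in>{1..lehmer_code w l}. px l - py j) = code_product n w"
      unfolding code_product_def using i by (subst prod.remove[of _ i]) auto
    finally have v: "code_product n ?v = code_product n w * (px i - py (Suc (lehmer_code w i)))"
      by (simp only: mult.commute)
    have code_s: "lehmer_code w (?s l) = lehmer_code w l" for l
      using eq by (cases "l = i"; cases "l = Suc i") auto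
    have "swap_x i (code_product n w) = (\<Prod>l\<in>{1..n}. \<Prod>j\<in>{1..lehmer_code w l}. px (?s l) - py j)"
      by (simp add: code_product_def swap_x_prod)
    also have "\<dots> = (\<Prod>l\<in>{1..n}. \<Prod>j\<in>{1..lehmer_code w (?s l)}. px (?s l) - py j)"
      by (simp only: code_s)
    also have "\<dots> = code_product n w"
      using prod.permute[OF simple_transp_permutes[OF i(1,2)], 
          of "\<lambda>l. \<Prod>j\<in>{1..lehmer_code w l}. px l - py j"]
      by (simp add: code_product_def comp_def)
    finally have "dd i (code_product n w) = 0" by (simp add: dd_eq_0_iff)
    moreover have "dd i (py j) = 0" for j by (simp add: dd_eq_0_iff)
    ultimately have "dd i (code_product n ?v) = code_product n w"
      unfolding v by (simp add: dd_symmetric_mult dd_diff dd_px)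
    then show ?thesis
      using schubert_in_ascent[OF step.hyps i] IH by simp
  qed
qed

text \<open>Both sides obey the same recursion below the longest element of $S_n$, and that element is
  dominant also as an element of $S_{n+1}$, where its polynomial is the same product.\<close>

lemma schubert_in_Suc:
  assumes "w permutes {1..n}"
  shows "schubert_in (Suc n) w = schubert_in n w"
  using assms
proof (induction w rule: permutes_ascent_induct)
  case (step w)
  have Suc: "w permutes {1..Suc n}" using step.hyps by (rule permutes_mono) simp
  show ?case
  proof (cases "w = longest_perm n")
    case True
    then have "schubert_in (Suc n) w = code_product (Suc n) w"
      using Suc dominant_longest_perm schubert_in_dominant by blast
    also have "\<dots> = code_product n w"
      using True by (simp add: code_product_def lehmer_code_longest_perm)
    also have "\<dots> = schubert_in n w"
      using step.hyps dominant_longest_perm schubert_in_dominant True by metis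
    finally show ?thesis .
  next
    case False
    then obtain i where i: "1 \<le> i" "i < n" "w i < w (Suc i)"
      using ascent_exists[OF step.hyps] by blast
    then show ?thesis
      using schubert_in_ascent[OF Suc, of i] schubert_in_ascent[OF step.hyps, of i] step.IH
      by (metis less_Suc_eq)
  qed
qed

definition schubert_limit :: "(nat \<Rightarrow> nat) \<Rightarrow> xypoly" where
  "schubert_limit w = (if w \<in> S_inf then schubert_in (LEAST n. w permutes {1..n}) w else 0)"

lemma schubert_limit_eq:
  assumes "w permutes {1..n}"
  shows "schubert_limit w = schubert_in n w"
proof -
  define m where "m = (LEAST n. w permutes {1..n})"
  have m: "w permutes {1..m}" unfolding m_def using assms by (rule LeastI)
  have "m \<le> n" unfolding m_def using assms by (rule Least_le)
  then have "schubert_in n w = schubert_in m w"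
    by (induction rule: dec_induct) (simp, metis schubert_in_Suc permutes_mono[OF m])
  then show ?thesis
    using permutes_S_inf[OF assms] by (simp add: schubert_limit_def m_def)
qed

lemma double_schubert_family_limit: "double_schubert_family schubert_limit"
  unfolding double_schubert_family_def
proof (intro conjI allI ballI impI)
  fix n
  show "schubert_limit (longest_perm n) = (\<Prod>(i, j)\<in>{(i, j). 1 \<le> i \<and> 1 \<le> j \<and> i + j \<le> n}. px i - py j)"
    unfolding schubert_limit_eq[OF longest_perm_permutes] schubert_in_longest_perm top_schubert_def ..
next
  fix w :: "nat \<Rightarrow> nat" and i :: nat
  assume w: "w \<in> S_inf" and i: "1 \<le> i"
  obtain n where "w permutes {1..n}" using w by (auto simp: S_inf_def)
  then have n: "w permutes {1..n + Suc i}" by (rule permutes_mono) simp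
  let ?n = "n + Suc i" and ?s = "simple_transp i"
  have in': "i < ?n" by simp
  have ws: "(w \<circ> ?s) permutes {1..?n}"
    using n i by (rule comp_simple_transp_permutes) simp
  show "dd i (schubert_limit w) = 
      (if inversions (w \<circ> ?s) < inversions w then schubert_limit (w \<circ> ?s) else 0)"
  proof (cases "w (Suc i) < w i")
    case True
    then have "schubert_in ?n (w \<circ> ?s) = dd i (schubert_in ?n w)"
      using schubert_in_ascent[OF ws i in'] by simp
    then show ?thesis 
      using True w i by (simp add: inversions_simple_transp_less_iff schubert_limit_eq[OF n] schubert_limit_eq[OF ws])
  next
    case False
    then have "w i < w (Suc i)" using S_inf_eq_iff[OF w, of i "Suc i"] by simp
    then have "schubert_in ?n w = dd i (schubert_in ?n (w \<circ> ?s))"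
      by (rule schubert_in_ascent[OF n i in'])
    then show ?thesis 
      using False w i by (simp add: inversions_simple_transp_less_iff schubert_limit_eq[OF n])
  qed
qed (simp add: schubert_limit_def)

lemma double_schubert_family_unique:
  assumes "double_schubert_family S"
  shows "S = schubert_limit"
proof
  fix w
  show "S w = schubert_limit w"
  proof (cases "w \<in> S_inf")
    case True
    then obtain n where "w permutes {1..n}" by (auto simp: S_inf_def)
    then show ?thesis
    proof (induction w rule: permutes_ascent_induct)
      case (step w)
      have fam: "double_schubert_family schubert_limit" by (rule double_schubert_family_limit)
      show ?case
      proof (cases "w = longest_perm n")
        case True
        then show ?thesis using assms fam by (simp add: double_schubert_family_def)
      next
        case False
        then obtain i where i: "1 \<le> i" "i < n" "w i < w (Suc i)"
          using ascent_exists[OF step.hyps] by blast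
        have w: "w \<in> S_inf" using step.hyps by (rule permutes_S_inf)
        then have v: "w \<circ> simple_transp i \<in> S_inf" using i by simp
        have "inversions w < inversions (w \<circ> simple_transp i)"
          using inversions_ascent[OF w i(3)] by simp
        then have "dd i (T (w \<circ> simple_transp i)) = T w" if "double_schubert_family T" for T
          using that v i by (simp add: double_schubert_family_def)
        then show ?thesis using assms fam step.IH[OF i] by metis
      qed
    qed
  next
    case False
    then show ?thesis using assms by (simp add: double_schubert_family_def schubert_limit_def)
  qed
qed

lemma double_schubert_eq_limit: "double_schubert = schubert_limit"
  unfolding double_schubert_def
  by (rule the_equality) (auto intro: double_schubert_family_limit double_schubert_family_unique)

lemma dd_double_schubert:
  assumes "w \<in> S_inf" "1 \<le> i"
  shows "dd i (double_schubert w) = (if w (Suc i) < w i then double_schubert (w \<circ> simple_transp i) else 0)"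
  using double_schubert_family_limit assms
  unfolding double_schubert_eq_limit double_schubert_family_def
  by (simp add: inversions_simple_transp_less_iff)

lemma double_schubert_id: "double_schubert id = 1"
proof -
  have "double_schubert (longest_perm 0) = code_product 0 (longest_perm 0)"
    unfolding double_schubert_eq_limit schubert_limit_eq[OF longest_perm_permutes]
      schubert_in_longest_perm code_product_longest_perm ..
  then show ?thesis by (simp add: longest_perm_0 code_product_def)
qed

lemma dominant_perm_permutes: "dominant_perm k permutes {1..k + 1}"
proof (rule bij_imp_permutes)
  show "bij_betw (dominant_perm k) {1..k + 1} {1..k + 1}"
    by (rule bij_betw_byWitness[of _ "\<lambda>i. if i = k + 1 then 1 else i + 1"]) 
      (auto simp: dominant_perm_def)
qed (auto simp: dominant_perm_def)

lemma lehmer_code_dominant_perm: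
  assumes "1 \<le> i"
  shows "lehmer_code (dominant_perm k) i = (if i = 1 then k else 0)"
proof (cases "i = 1")
  case True
  have "{j. i < j \<and> dominant_perm k j < dominant_perm k i} = {2..k + 1}"
    unfolding True by (auto simp: dominant_perm_def)
  then show ?thesis using True by (simp add: lehmer_code_def)
next
  case False
  have "{j. i < j \<and> dominant_perm k j < dominant_perm k i} = {}"
    using assms False by (auto simp: dominant_perm_def)
  then show ?thesis using False by (simp only: lehmer_code_def card.empty if_False)
qed

lemma double_schubert_dominant_perm:
  "double_schubert (dominant_perm k) = (\<Prod>j\<in>{1..k}. px 1 - py j)"
proof -
  have "dominant (dominant_perm k)" by (simp add: dominant_def lehmer_code_dominant_perm)
  then have "double_schubert (dominant_perm k) = code_product (k + 1) (dominant_perm k)"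
    unfolding double_schubert_eq_limit schubert_limit_eq[OF dominant_perm_permutes]
    by (rule schubert_in_dominant[OF dominant_perm_permutes])
  also have "\<dots> = (\<Prod>i\<in>{1..k + 1}. if i = 1 then \<Prod>j\<in>{1..k}. px 1 - py j else 1)"
    unfolding code_product_def by (rule prod.cong) (auto simp: lehmer_code_dominant_perm)
  also have "\<dots> = (\<Prod>j\<in>{1..k}. px 1 - py j)" by (subst prod.delta) auto
  finally show ?thesis .
qed

lemma hessenberg_poly_eq: "hessenberg_poly n k = (\<Prod>j\<in>{1..k}. px 1 - px (n + 1 - j))"
  by (simp add: hessenberg_poly_def double_schubert_dominant_perm psubst_simps)

section \<open>Divided differences indexed by permutations\<close>

text \<open>The composite $\partial_w$ of divided differences along a reduced word of \<open>w\<close>. It is the operator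
  itself that is built recursively, so the step prepends $\partial_i$ on the argument side.\<close>

definition dd_perm :: "(nat \<Rightarrow> nat) \<Rightarrow> xypoly \<Rightarrow> xypoly" where
  "dd_perm w = along_descents (\<lambda>i F. F \<circ> dd i) id w"

lemma dd_perm_id [simp]: "dd_perm id f = f"
  by (simp add: dd_perm_def)

lemma dd_perm_descent:
  assumes "w \<in> S_inf" "w (Suc i) < w i"
  shows "dd_perm w f = dd_perm (w \<circ> simple_transp i) (dd i f)"
proof -
  have "dd_perm w = dd_perm (w \<circ> simple_transp i) \<circ> dd i"
    unfolding dd_perm_def
    by (rule along_descents_step[where A = "\<lambda>i F. F \<circ> dd i"])
      (use assms dd_commute dd_braid in \<open>auto simp: fun_eq_iff\<close>)
  then show ?thesis by simp
qed

lemma dd_perm_0 [simp]: "w \<in> S_inf \<Longrightarrow> dd_perm w 0 = 0"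
proof (induction w rule: S_inf_descent_induct)
  case (descent w i)
  show ?case unfolding dd_perm_descent[OF descent.hyps(1,3)] dd_0 by (rule descent.IH)
qed (rule dd_perm_id)

lemma dd_perm_dd:
  assumes "w \<in> S_inf" "1 \<le> i"
  shows "dd_perm w (dd i f) = (if w i < w (Suc i) then dd_perm (w \<circ> simple_transp i) f else 0)"
proof (cases "w i < w (Suc i)")
  case True
  then show ?thesis 
    using dd_perm_descent[of "w \<circ> simple_transp i" i f] assms by simp
next
  case False
  then have "w (Suc i) < w i" using S_inf_eq_iff[OF assms(1), of i "Suc i"] by simp
  then show ?thesis using False assms by (simp add: dd_perm_descent[of w i])
qed

lemma dd_perm_add: "w \<in> S_inf \<Longrightarrow> dd_perm w (f + g) = dd_perm w f + dd_perm w g"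
proof (induction w arbitrary: f g rule: S_inf_descent_induct)
  case (descent w i)
  show ?case unfolding dd_perm_descent[OF descent.hyps(1,3)] dd_add by (rule descent.IH)
qed (simp only: dd_perm_id)

lemma dd_perm_diff: "w \<in> S_inf \<Longrightarrow> dd_perm w (f - g) = dd_perm w f - dd_perm w g"
proof (induction w arbitrary: f g rule: S_inf_descent_induct)
  case (descent w i)
  show ?case unfolding dd_perm_descent[OF descent.hyps(1,3)] dd_diff by (rule descent.IH)
qed (simp only: dd_perm_id)

lemma dd_perm_of_int_mult: "w \<in> S_inf \<Longrightarrow> dd_perm w (of_int c * f) = of_int c * dd_perm w f"
proof (induction w arbitrary: f rule: S_inf_descent_induct)
  case (descent w i)
  show ?case
    unfolding dd_perm_descent[OF descent.hyps(1,3)] dd_symmetric_mult[OF dd_of_int] by (rule descent.IH)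
qed (simp only: dd_perm_id)

text \<open>An element of $S_n$ only has descents below \<open>n\<close>, so only the operators $\partial_i$ with \<open>i < n\<close>
  occur in $\partial_w$, and these are linear over the symmetric polynomials.\<close>

lemma dd_perm_symmetric_mult:
  assumes "w permutes {1..n}" "\<And>i. 1 \<le> i \<Longrightarrow> i < n \<Longrightarrow> dd i g = 0"
  shows "dd_perm w (g * f) = g * dd_perm w f"
proof -
  have "w \<in> S_inf" using assms(1) by (rule permutes_S_inf)
  then show ?thesis using assms(1)
  proof (induction w arbitrary: f rule: S_inf_descent_induct)
    case (descent w i)
    have "i < n" using descent_bound descent.hyps descent.prems by blast
    then have "(w \<circ> simple_transp i) permutes {1..n}"
      using comp_simple_transp_permutes descent.hyps descent.prems by blast
    from descent.IH[OF this] show ?case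
      unfolding dd_perm_descent[OF descent.hyps(1,3)]
        dd_symmetric_mult[OF assms(2)[OF descent.hyps(2) \<open>i < n\<close>]] .
  qed (simp only: dd_perm_id)
qed

text \<open>This functional extracts the coefficient of the Schubert polynomial of \<open>w\<close>: the Schubert
  polynomials form the dual basis, as shown below.\<close>

definition schubert_coeff :: "(nat \<Rightarrow> nat) \<Rightarrow> xypoly \<Rightarrow> int" where
  "schubert_coeff w f = const_term (dd_perm w f)"

lemma schubert_coeff_id [simp]: "schubert_coeff id f = const_term f"
  by (simp add: schubert_coeff_def)

lemma schubert_coeff_descent:
  "w \<in> S_inf \<Longrightarrow> w (Suc i) < w i \<Longrightarrow> schubert_coeff w f = schubert_coeff (w \<circ> simple_transp i) (dd i f)"
  by (simp add: schubert_coeff_def dd_perm_descent)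

lemma schubert_coeff_dd:
  "w \<in> S_inf \<Longrightarrow> 1 \<le> i \<Longrightarrow>
    schubert_coeff w (dd i f) = (if w i < w (Suc i) then schubert_coeff (w \<circ> simple_transp i) f else 0)"
  by (simp add: schubert_coeff_def dd_perm_dd)

lemma schubert_coeff_0 [simp]: "w \<in> S_inf \<Longrightarrow> schubert_coeff w 0 = 0"
  by (simp add: schubert_coeff_def)

lemma schubert_coeff_add: "w \<in> S_inf \<Longrightarrow> schubert_coeff w (f + g) = schubert_coeff w f + schubert_coeff w g"
  by (simp add: schubert_coeff_def dd_perm_add const_term_add)

lemma schubert_coeff_diff: "w \<in> S_inf \<Longrightarrow> schubert_coeff w (f - g) = schubert_coeff w f - schubert_coeff w g"
  by (simp add: schubert_coeff_def dd_perm_diff const_term_diff)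

lemma schubert_coeff_of_int_mult: "w \<in> S_inf \<Longrightarrow> schubert_coeff w (of_int c * f) = c * schubert_coeff w f"
  by (simp add: schubert_coeff_def dd_perm_of_int_mult const_term_mult)

lemma schubert_coeff_sum: "w \<in> S_inf \<Longrightarrow> schubert_coeff w (sum g A) = (\<Sum>a\<in>A. schubert_coeff w (g a))"
  by (induction A rule: infinite_finite_induct) (auto simp: schubert_coeff_add)

section \<open>Homogeneous polynomials\<close>

text \<open>Doubling all variables multiplies a monomial of degree \<open>d\<close> by $2^d$, so over the integers this
  equation says that all monomials of \<open>P\<close> have degree \<open>d\<close>. In this form homogeneity passes through
  divided differences, because doubling is a substitution that commutes with swapping variables.\<close>

definition homogeneous :: "nat \<Rightarrow> xypoly \<Rightarrow> bool" where
  "homogeneous d P \<longleftrightarrow> psubst (\<lambda>v. 2 * pvar v) P = 2 ^ d * P"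

lemma homogeneous_0 [simp]: "homogeneous d 0"
  by (simp add: homogeneous_def)

lemma homogeneous_1 [simp]: "homogeneous 0 1"
  by (simp add: homogeneous_def)

lemma homogeneous_pvar [simp]: "homogeneous (Suc 0) (pvar v)"
  by (simp add: homogeneous_def)

lemma homogeneous_add: "homogeneous d P \<Longrightarrow> homogeneous d Q \<Longrightarrow> homogeneous d (P + Q)"
  by (simp add: homogeneous_def psubst_simps distrib_left)

lemma homogeneous_diff: "homogeneous d P \<Longrightarrow> homogeneous d Q \<Longrightarrow> homogeneous d (P - Q)"
  by (simp add: homogeneous_def psubst_simps right_diff_distrib)

lemma homogeneous_of_int_mult: "homogeneous d P \<Longrightarrow> homogeneous d (of_int c * P)"
  by (simp add: homogeneous_def psubst_simps ac_simps)

lemma homogeneous_sum: "(\<And>a. a \<in> A \<Longrightarrow> homogeneous d (g a)) \<Longrightarrow> homogeneous d (sum g A)"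
  by (induction A rule: infinite_finite_induct) (auto simp: homogeneous_add)

lemma homogeneous_mult: "homogeneous d P \<Longrightarrow> homogeneous e Q \<Longrightarrow> homogeneous (d + e) (P * Q)"
  by (simp add: homogeneous_def psubst_simps power_add)

lemma homogeneous_prod: "(\<And>a. a \<in> A \<Longrightarrow> homogeneous (Suc 0) (g a)) \<Longrightarrow> homogeneous (card A) (prod g A)"
  by (induction A rule: infinite_finite_induct) (auto intro: homogeneous_mult[of "Suc 0", simplified])

lemma homogeneous_const_term:
  assumes "homogeneous d P" "0 < d"
  shows "const_term P = 0"
proof -
  have "psubst (\<lambda>_. 0) P = psubst (\<lambda>_. 0) (psubst (\<lambda>v. 2 * pvar v) P)"
    unfolding psubst_psubst by (simp add: psubst_mult)
  also have "\<dots> = 2 ^ d * psubst (\<lambda>_. 0) P"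
    using assms(1) unfolding homogeneous_def by (simp add: psubst_mult psubst_power)
  finally have "(of_int (const_term P) :: xypoly) = of_int (2 ^ d * const_term P)"
    by (simp add: psubst_zero)
  then have "const_term P = 2 ^ d * const_term P"
    by (simp only: of_int_eq_iff)
  moreover have "1 < (2::int) ^ d" using assms(2) by (intro one_less_power) auto
  ultimately show ?thesis by (metis less_irrefl mult_cancel_right2)
qed

lemma power2_symmetric: "dd i (2 ^ d) = 0"
  using dd_of_int[of i "2 ^ d"] by simp

lemma dd_scale: "2 * psubst (\<lambda>v. 2 * pvar v) (dd i P) = dd i (psubst (\<lambda>v. 2 * pvar v) P)"
proof (rule dd_psubst)
  fix v show "swap_x i (2 * pvar v) = psubst (\<lambda>v. 2 * pvar v) (swap_x i (pvar v))"
    using swap_x_simps(3)[of i 2] by (cases v) auto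
qed (simp add: algebra_simps)

lemma homogeneous_dd:
  assumes "homogeneous (Suc d) P"
  shows "homogeneous d (dd i P)"
proof -
  have "2 * psubst (\<lambda>v. 2 * pvar v) (dd i P) = 2 * (2 ^ d * dd i P)"
    using assms unfolding dd_scale homogeneous_def 
    by (simp only:) (simp add: dd_symmetric_mult power2_symmetric flip: power_Suc mult.assoc)
  then show ?thesis by (simp add: homogeneous_def)
qed

text \<open>The divided difference of a polynomial of degree 0 would have degree -1: it is divisible by
  every power of 2.\<close>

lemma homogeneous_0_dd:
  assumes "homogeneous 0 P"
  shows "dd i P = 0"
proof -
  define R where "R = dd i P"
  have R: "R = 2 * psubst (\<lambda>v. 2 * pvar v) R"
    using assms unfolding R_def dd_scale by (simp add: homogeneous_def)
  have "\<exists>X. R = 2 ^ N * X" for N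
  proof (induction N)
    case (Suc N)
    then obtain X where X: "R = 2 ^ N * X" by blast
    have "R = 2 * psubst (\<lambda>v. 2 * pvar v) (2 ^ N * X)" using R by (simp only: flip: X)
    also have "\<dots> = 2 ^ Suc N * psubst (\<lambda>v. 2 * pvar v) X" by (simp add: psubst_simps)
    finally show ?case by blast
  qed simp
  moreover have "Poly_Mapping.lookup (2 ^ N * X) m = 2 ^ N * Poly_Mapping.lookup X m" 
    for N m and X :: xypoly
  proof (induction N)
    case (Suc N)
    have "Poly_Mapping.lookup (2 ^ Suc N * X) m = Poly_Mapping.lookup (2 ^ N * X + 2 ^ N * X) m"
      by (simp only: power_Suc mult.assoc mult_2 distrib_right)
    then show ?case unfolding lookup_add Suc by simp
  qed simp
  ultimately have dvd: "2 ^ N dvd Poly_Mapping.lookup R m" for N m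
    by (metis dvd_triv_left)
  have "R = 0"
  proof (rule poly_mapping_eqI)
    fix m
    define r where "r = Poly_Mapping.lookup R m"
    have "int (nat \<bar>r\<bar>) < int (2 ^ nat \<bar>r\<bar>)" unfolding of_nat_less_iff by (rule less_exp)
    then have "\<not> 2 ^ nat \<bar>r\<bar> \<le> \<bar>r\<bar>" by simp
    then have "r = 0"
      using dvd[of "nat \<bar>r\<bar>" m] dvd_imp_le_int[of r "2 ^ nat \<bar>r\<bar>"] by (auto simp: r_def)
    then show "Poly_Mapping.lookup R m = Poly_Mapping.lookup 0 m" by (simp add: r_def)
  qed
  then show ?thesis by (simp add: R_def)
qed

lemma homogeneous_dd_perm:
  assumes "w \<in> S_inf" "homogeneous d f"
  shows "if inversions w \<le> d then homogeneous (d - inversions w) (dd_perm w f) else dd_perm w f = 0"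
  using assms
proof (induction w arbitrary: d f rule: S_inf_descent_induct)
  case (descent w i)
  have len: "inversions w = Suc (inversions (w \<circ> simple_transp i))"
    using inversions_descent descent.hyps by blast
  have D: "dd_perm w f = dd_perm (w \<circ> simple_transp i) (dd i f)"
    using dd_perm_descent descent.hyps by blast
  show ?case
  proof (cases d)
    case 0
    then show ?thesis using descent.prems descent.hyps len D by (simp add: homogeneous_0_dd)
  next
    case (Suc e)
    then have "homogeneous e (dd i f)" using homogeneous_dd descent.prems by blast
    from descent.IH[OF this] show ?thesis unfolding len D Suc by (simp only: Suc_le_mono diff_Suc_Suc)
  qed
qed simp

lemma schubert_coeff_homogeneous:
  assumes "w \<in> S_inf" "homogeneous d f" "schubert_coeff w f \<noteq> 0"
  shows "inversions w = d"
  using homogeneous_dd_perm[OF assms(1,2)] assms(3) homogeneous_const_term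
  unfolding schubert_coeff_def by (metis const_term_0 diff_is_0_eq' le_antisym not_gr_zero zero_less_diff linorder_not_le)

section \<open>Polynomials in the positively indexed x-variables\<close>

text \<open>Invariance under the substitution that kills $x_0$ and all $y_j$ means that only
  $x_1, x_2, \ldots$ occur.\<close>

fun keep_x :: "var \<Rightarrow> xypoly" where
  "keep_x (VX i) = (if i = 0 then 0 else px i)"
| "keep_x (VY j) = 0"

definition in_x :: "xypoly \<Rightarrow> bool" where
  "in_x P \<longleftrightarrow> psubst keep_x P = P"

lemma in_x_0 [simp]: "in_x 0" by (simp add: in_x_def)
lemma in_x_1 [simp]: "in_x 1" by (simp add: in_x_def)
lemma in_x_px [simp]: "1 \<le> i \<Longrightarrow> in_x (px i)" by (simp add: in_x_def)
lemma in_x_of_int [simp]: "in_x (of_int c)" by (simp add: in_x_def)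
lemma in_x_add: "in_x P \<Longrightarrow> in_x Q \<Longrightarrow> in_x (P + Q)" by (simp add: in_x_def psubst_simps)
lemma in_x_diff: "in_x P \<Longrightarrow> in_x Q \<Longrightarrow> in_x (P - Q)" by (simp add: in_x_def psubst_simps)
lemma in_x_mult: "in_x P \<Longrightarrow> in_x Q \<Longrightarrow> in_x (P * Q)" by (simp add: in_x_def psubst_simps)
lemma in_x_sum: "(\<And>a. a \<in> A \<Longrightarrow> in_x (g a)) \<Longrightarrow> in_x (sum g A)"
  by (induction A rule: infinite_finite_induct) (auto simp: in_x_add)
lemma in_x_prod: "(\<And>a. a \<in> A \<Longrightarrow> in_x (g a)) \<Longrightarrow> in_x (prod g A)"
  by (induction A rule: infinite_finite_induct) (auto simp: in_x_mult)

lemma in_x_dd: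
  assumes "in_x P" "1 \<le> i"
  shows "in_x (dd i P)"
proof -
  have "1 * psubst keep_x (dd i P) = dd i (psubst keep_x P)"
  proof (rule dd_psubst)
    fix v show "swap_x i (keep_x v) = psubst keep_x (swap_x i (pvar v))"
      using assms(2) by (cases v) (auto simp: simple_transp_def transpose_def)
  qed (use assms(2) in auto)
  then show ?thesis using assms(1) by (simp add: in_x_def)
qed

text \<open>A polynomial invariant under all permutations of its variables is constant: moving all its
  variables to fresh places and then setting the original ones to 0 changes nothing, but leaves
  only the constant term.\<close>

lemma all_dd_0_imp_const:
  assumes "in_x Q" "\<And>i. 1 \<le> i \<Longrightarrow> dd i Q = 0"
  shows "Q = of_int (const_term Q)"
proof -
  have inv: "rename_x \<sigma> Q = Q" if "\<sigma> \<in> S_inf" for \<sigma>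
    using that
  proof (induction \<sigma> rule: S_inf_descent_induct)
    case (descent w i)
    have "rename_x w Q = rename_x (w \<circ> simple_transp i) (rename_x (simple_transp i) Q)"
      by (simp add: rename_x_rename_x)
    also have "rename_x (simple_transp i) Q = Q"
      using assms(2)[OF descent.hyps(2)] by (simp add: dd_eq_0_iff swap_x_eq)
    finally show ?case using descent.IH by simp
  qed (rule rename_x_id)
  \<comment> \<open>\<open>\<sigma>\<close> exchanges the places up to \<open>N\<close>, which contain all variables of \<open>Q\<close>, with \<open>N\<close> fresh ones,
     and \<open>\<pi>\<close> kills the original ones.\<close>
  define N where "N = Max (insert 0 {i. VX i \<in> poly_vars Q})"
  have "finite {i. VX i \<in> poly_vars Q}"
    using finite_vimageI[OF finite_poly_vars[of Q], of VX] by (simp add: vimage_def inj_def)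
  then have N: "i \<le> N" if "VX i \<in> poly_vars Q" for i
    using that by (simp add: N_def)
  define \<sigma> where "\<sigma> i = (if i \<in> {1..N} then i + N else if i \<in> {N+1..2*N} then i - N else i)" for i
  have "\<sigma> permutes {1..2*N}"
  proof (rule bij_imp_permutes)
    show "bij_betw \<sigma> {1..2*N} {1..2*N}"
      by (rule bij_betw_byWitness[of _ \<sigma>]) (auto simp: \<sigma>_def)
  qed (auto simp: \<sigma>_def)
  then have \<sigma>: "rename_x \<sigma> Q = Q" by (intro inv permutes_S_inf)
  define \<pi> where "\<pi> v = (case v of VX i \<Rightarrow> if i \<le> N then 0 else px i | VY j \<Rightarrow> 0)" for v
  have "psubst \<pi> (rename_x \<sigma> Q) = rename_x \<sigma> (psubst keep_x Q)"
    unfolding rename_x_def psubst_psubst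
  proof (rule psubst_cong)
    fix v assume v: "v \<in> poly_vars Q"
    show "psubst \<pi> (subst_xy (\<lambda>k. px (\<sigma> k)) py v) = psubst (subst_xy (\<lambda>k. px (\<sigma> k)) py) (keep_x v)"
      using N v by (cases v) (auto simp: \<pi>_def \<sigma>_def)
  qed
  then have "psubst \<pi> Q = Q" using \<sigma> assms(1) by (simp add: in_x_def)
  moreover have "psubst \<pi> Q = psubst (\<lambda>_. 0) Q"
    by (rule psubst_cong) (use N in \<open>auto simp: \<pi>_def split: var.split\<close>)
  ultimately show ?thesis by (simp add: psubst_zero)
qed

section \<open>Expansion in Schubert polynomials\<close>

lemma dd_schubert:
  assumes "w \<in> S_inf" "1 \<le> i"
  shows "dd i (schubert w) = (if w (Suc i) < w i then schubert (w \<circ> simple_transp i) else 0)"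
proof -
  let ?f = "subst_xy px (\<lambda>j. 0)"
  have "1 * psubst ?f (dd i P) = dd i (psubst ?f P)" for P
  proof (rule dd_psubst)
    fix v show "swap_x i (?f v) = psubst ?f (swap_x i (pvar v))" by (cases v) auto
  qed simp
  from this[of "double_schubert w"]
  have "dd i (schubert w) = psubst ?f (dd i (double_schubert w))"
    by (simp add: schubert_def)
  then show ?thesis
    unfolding dd_double_schubert[OF assms] by (simp add: schubert_def)
qed

lemma schubert_id: "schubert id = 1"
  by (simp add: schubert_def double_schubert_id)

lemma schubert_longest_perm:
  "schubert (longest_perm n) = (\<Prod>(i, j)\<in>{(i, j). 1 \<le> i \<and> 1 \<le> j \<and> i + j \<le> n}. px i)"
proof -
  have "schubert (longest_perm n) = psubst (subst_xy px (\<lambda>j. 0)) (top_schubert n)"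
    unfolding schubert_def double_schubert_eq_limit schubert_limit_eq[OF longest_perm_permutes] 
      schubert_in_longest_perm ..
  then show ?thesis
    by (simp add: top_schubert_def psubst_prod case_prod_beta psubst_simps)
qed

text \<open>Both properties hold for the top polynomials and are inherited by divided differences. The degree
  is identified later: it must be the length, because $\partial_w \mathfrak{S}_w = 1$.\<close>

lemma schubert_in_x_homogeneous:
  assumes "w \<in> S_inf"
  shows "in_x (schubert w) \<and> (\<exists>d. homogeneous d (schubert w))"
proof -
  obtain n where "w permutes {1..n}" using assms by (auto simp: S_inf_def)
  then show ?thesis
  proof (induction w rule: permutes_ascent_induct)
    case (step w)
    show ?case
    proof (cases "w = longest_perm n")
      case True
      have "in_x (schubert w)"
        unfolding True schubert_longest_perm by (rule in_x_prod) auto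
      moreover have "homogeneous (card {(i, j). 1 \<le> i \<and> 1 \<le> j \<and> i + j \<le> n}) (schubert w)"
        unfolding True schubert_longest_perm by (rule homogeneous_prod) auto
      ultimately show ?thesis by blast
    next
      case False
      then obtain i where i: "1 \<le> i" "i < n" "w i < w (Suc i)"
        using ascent_exists[OF step.hyps] by blast
      have "(w \<circ> simple_transp i) \<in> S_inf" 
        using step.hyps i by (intro comp_simple_transp_S_inf permutes_S_inf)
      then have eq: "schubert w = dd i (schubert (w \<circ> simple_transp i))"
        using i by (simp add: dd_schubert)
      obtain d where d: "in_x (schubert (w \<circ> simple_transp i))" 
          "homogeneous d (schubert (w \<circ> simple_transp i))"
        using step.IH[OF i] by blast
      have "\<exists>e. homogeneous e (schubert w)"
        using d(2) homogeneous_dd homogeneous_0_dd homogeneous_0 unfolding eq by (cases d) metis+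
      then show ?thesis using in_x_dd[OF d(1) i(1)] eq by simp
    qed
  qed
qed

lemma dd_perm_schubert_self: "w \<in> S_inf \<Longrightarrow> dd_perm w (schubert w) = 1"
proof (induction w rule: S_inf_descent_induct)
  case (descent w i)
  have "dd i (schubert w) = schubert (w \<circ> simple_transp i)"
    unfolding dd_schubert[OF descent.hyps(1,2)] using descent.hyps(3) by simp
  then show ?case unfolding dd_perm_descent[OF descent.hyps(1,3)] using descent.IH by metis
qed (simp only: schubert_id dd_perm_id)

lemma homogeneous_schubert:
  assumes "w \<in> S_inf"
  shows "homogeneous (inversions w) (schubert w)"
proof -
  obtain d where d: "homogeneous d (schubert w)" using schubert_in_x_homogeneous[OF assms] by blast
  have "schubert_coeff w (schubert w) \<noteq> 0"
    by (simp add: schubert_coeff_def dd_perm_schubert_self[OF assms])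
  then show ?thesis using schubert_coeff_homogeneous[OF assms d] d by simp
qed

text \<open>Along a descent \<open>i\<close> of \<open>v\<close> both sides either pass to \<open>v s\<^sub>i\<close> and \<open>w s\<^sub>i\<close>, or \<open>w\<close> has an ascent at
  \<open>i\<close> and $\partial_i$ annihilates its polynomial. What remains is that a Schubert polynomial of positive degree
  has no constant term.\<close>

lemma schubert_coeff_schubert:
  assumes "v \<in> S_inf" "w \<in> S_inf"
  shows "schubert_coeff v (schubert w) = (if v = w then 1 else 0)"
  using assms
proof (induction v arbitrary: w rule: S_inf_descent_induct)
  case id
  show ?case
  proof (cases "w = id")
    case False
    then have "0 < inversions w" using inversions_eq_0_iff[OF id] by simp
    then have "const_term (schubert w) = 0"
      by (rule homogeneous_const_term[OF homogeneous_schubert[OF id]])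
    then show ?thesis unfolding schubert_coeff_id using False by metis
  next
    case True
    then show ?thesis unfolding schubert_coeff_id by (simp add: schubert_id)
  qed
next
  case (descent v i)
  have "v \<circ> simple_transp i = w \<circ> simple_transp i \<longleftrightarrow> v = w"
    by (metis comp_simple_transp_cancel)
  moreover have S: "v \<circ> simple_transp i \<in> S_inf" "w \<circ> simple_transp i \<in> S_inf"
    using descent.hyps(1,2) descent.prems by auto
  moreover have "schubert_coeff v (schubert w) = (if w (Suc i) < w i
      then schubert_coeff (v \<circ> simple_transp i) (schubert (w \<circ> simple_transp i)) else 0)"
    unfolding schubert_coeff_descent[OF descent.hyps(1,3)] dd_schubert[OF descent.prems descent.hyps(2)]
    using S by simp
  ultimately show ?case
    using descent.IH[OF S(2)] descent.hyps(3) by metis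
qed

text \<open>The functionals separate polynomials: by induction on the degree all divided differences of \<open>Q\<close>
  vanish, so \<open>Q\<close> is symmetric in infinitely many variables and hence constant.\<close>

lemma homogeneous_eq_0I:
  assumes "homogeneous d Q" "in_x Q" "\<And>u. u \<in> S_inf \<Longrightarrow> schubert_coeff u Q = 0"
  shows "Q = 0"
  using assms
proof (induction d arbitrary: Q)
  case 0
  then have "Q = of_int (const_term Q)"
    by (intro all_dd_0_imp_const) (auto simp: homogeneous_0_dd)
  moreover have "const_term Q = 0" by (rule 0(3)[OF id_S_inf, unfolded schubert_coeff_id])
  ultimately show ?case by simp
next
  case (Suc d)
  have "dd i Q = 0" if i: "1 \<le> i" for i
  proof (rule Suc.IH)
    show "homogeneous d (dd i Q)" using Suc.prems homogeneous_dd by blast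
    show "in_x (dd i Q)" using Suc.prems i in_x_dd by blast
    show "schubert_coeff u (dd i Q) = 0" if "u \<in> S_inf" for u
      unfolding schubert_coeff_dd[OF that i]
      using Suc.prems(3) comp_simple_transp_S_inf[OF that i] by metis
  qed
  then have "Q = of_int (const_term Q)"
    using Suc.prems by (intro all_dd_0_imp_const) auto
  moreover have "const_term Q = 0" by (rule Suc.prems(3)[OF id_S_inf, unfolded schubert_coeff_id])
  ultimately show ?case by simp
qed

lemma dd_eq_0_if_no_vars:
  assumes "VX i \<notin> poly_vars P" "VX (Suc i) \<notin> poly_vars P"
  shows "dd i P = 0"
proof -
  have "swap_x i P = psubst pvar P"
    unfolding swap_x_def
  proof (rule psubst_cong)
    fix v assume "v \<in> poly_vars P"
    then show "subst_xy (\<lambda>k. px (simple_transp i k)) py v = pvar v"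
      using assms by (cases v) (auto simp: simple_transp_def transpose_def)
  qed
  then show ?thesis by (simp add: dd_eq_0_iff)
qed

text \<open>Only finitely many $\partial_i P$ are nonzero, since \<open>P\<close> has finitely many variables, and each of them
  has smaller degree.\<close>

lemma finite_schubert_coeffs:
  assumes "homogeneous d P"
  shows "finite {u \<in> S_inf. schubert_coeff u P \<noteq> 0}"
  using assms
proof (induction d arbitrary: P)
  case 0
  have "{u \<in> S_inf. schubert_coeff u P \<noteq> 0} \<subseteq> {id}"
    using schubert_coeff_homogeneous[OF _ 0] inversions_eq_0_iff by blast
  then show ?case using finite_subset by blast
next
  case (Suc d)
  let ?I = "{i. dd i P \<noteq> 0}"
  have "?I \<subseteq> VX -` poly_vars P \<union> (\<lambda>i. VX (Suc i)) -` poly_vars P"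
    using dd_eq_0_if_no_vars by blast
  then have fin: "finite ?I"
    by (rule finite_subset) (auto intro!: finite_vimageI simp: inj_def)
  have "{u \<in> S_inf. schubert_coeff u P \<noteq> 0} \<subseteq> 
    insert id (\<Union>i\<in>?I. (\<lambda>v. v \<circ> simple_transp i) ` {v \<in> S_inf. schubert_coeff v (dd i P) \<noteq> 0})"
  proof
    fix u assume u: "u \<in> {u \<in> S_inf. schubert_coeff u P \<noteq> 0}"
    show "u \<in> insert id (\<Union>i\<in>?I. (\<lambda>v. v \<circ> simple_transp i) ` {v \<in> S_inf. schubert_coeff v (dd i P) \<noteq> 0})"
    proof (cases "u = id")
      case False
      then obtain i where i: "1 \<le> i" "u (Suc i) < u i" using descent_exists u by blast
      let ?v = "u \<circ> simple_transp i"
      have v: "?v \<in> S_inf" "schubert_coeff ?v (dd i P) \<noteq> 0"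
        using u i schubert_coeff_descent[of u i P] by auto
      then have "dd i P \<noteq> 0" by auto
      moreover have "u = ?v \<circ> simple_transp i" by simp
      ultimately show ?thesis using v by blast
    qed simp
  qed
  moreover have "finite {v \<in> S_inf. schubert_coeff v (dd i P) \<noteq> 0}" for i
    using Suc homogeneous_dd by blast
  ultimately show ?case using fin by (auto intro: finite_subset)
qed

text \<open>Subtracting from \<open>P\<close> the combination with coefficients \<open>schubert_coeff u P\<close> leaves a polynomial on
  which all functionals vanish. Uniqueness is duality. The index set is right because \<open>u\<close> with a
  descent beyond \<open>n\<close> starts with a divided difference that annihilates \<open>P\<close>.\<close>

lemma schubert_expansion:
  assumes "homogeneous d P" "in_x P" "\<And>i. n < i \<Longrightarrow> dd i P = 0"
  shows "\<exists>!c. Poly_Mapping.keys c \<subseteq> schubert_index n \<and>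
      P = (\<Sum>u\<in>Poly_Mapping.keys c. of_int (Poly_Mapping.lookup c u) * schubert u)"
    and "Poly_Mapping.keys c \<subseteq> schubert_index n \<Longrightarrow>
      P = (\<Sum>u\<in>Poly_Mapping.keys c. of_int (Poly_Mapping.lookup c u) * schubert u) \<Longrightarrow> v \<in> S_inf \<Longrightarrow>
      Poly_Mapping.lookup c v = schubert_coeff v P"
proof -
  let ?expansion = "\<lambda>c. Poly_Mapping.keys c \<subseteq> schubert_index n \<and>
      P = (\<Sum>u\<in>Poly_Mapping.keys c. of_int (Poly_Mapping.lookup c u) * schubert u)"
  have index: "schubert_index n \<subseteq> S_inf" by (auto simp: schubert_index_def)
  have coeff_sum: "schubert_coeff v (\<Sum>u\<in>Poly_Mapping.keys c. of_int (Poly_Mapping.lookup c u) * schubert u)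
      = Poly_Mapping.lookup c v" 
    if "Poly_Mapping.keys c \<subseteq> S_inf" "v \<in> S_inf" for c v
  proof -
    have "schubert_coeff v (\<Sum>u\<in>Poly_Mapping.keys c. of_int (Poly_Mapping.lookup c u) * schubert u)
      = (\<Sum>u\<in>Poly_Mapping.keys c. if v = u then Poly_Mapping.lookup c u else 0)"
      unfolding schubert_coeff_sum[OF that(2)]
    proof (rule sum.cong[OF refl])
      fix u assume "u \<in> Poly_Mapping.keys c"
      then have "u \<in> S_inf" using that by blast
      then show "schubert_coeff v (of_int (Poly_Mapping.lookup c u) * schubert u) =
          (if v = u then Poly_Mapping.lookup c u else 0)"
        using that(2) by (simp add: schubert_coeff_of_int_mult schubert_coeff_schubert)
    qed
    also have "\<dots> = Poly_Mapping.lookup c v" by (simp add: sum.delta' in_keys_iff)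
    finally show ?thesis .
  qed
  have coeff: "Poly_Mapping.lookup c v = schubert_coeff v P" if "?expansion c" "v \<in> S_inf" for c v
  proof -
    have "Poly_Mapping.keys c \<subseteq> S_inf" using that(1) index by blast
    then show ?thesis
      using arg_cong[OF conjunct2[OF that(1)], of "schubert_coeff v"] coeff_sum[OF _ that(2)] by metis
  qed
  define U where "U = {u \<in> S_inf. schubert_coeff u P \<noteq> 0}"
  define c where "c = Abs_poly_mapping (\<lambda>u. if u \<in> S_inf then schubert_coeff u P else 0)"
  have "finite U" unfolding U_def by (rule finite_schubert_coeffs[OF assms(1)])
  moreover have "{u. (if u \<in> S_inf then schubert_coeff u P else 0) \<noteq> 0} = U"
  proof (rule set_eqI)
    fix u show "u \<in> {u. (if u \<in> S_inf then schubert_coeff u P else 0) \<noteq> 0} \<longleftrightarrow> u \<in> U"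
      unfolding mem_Collect_eq U_def by (cases "u \<in> S_inf") simp_all
  qed
  ultimately have lookup: "Poly_Mapping.lookup c u = (if u \<in> S_inf then schubert_coeff u P else 0)" for u
    unfolding c_def by (subst lookup_Abs_poly_mapping) auto
  have keys: "Poly_Mapping.keys c = U"
  proof (rule set_eqI)
    fix u show "u \<in> Poly_Mapping.keys c \<longleftrightarrow> u \<in> U"
      unfolding in_keys_iff lookup mem_Collect_eq U_def by (cases "u \<in> S_inf") simp_all
  qed
  have "U \<subseteq> schubert_index n"
  proof
    fix u assume u: "u \<in> U"
    have "u i < u (i + 1)" if "n < i" for i
    proof (rule ccontr)
      assume "\<not> u i < u (i + 1)"
      then have "u (Suc i) < u i" using S_inf_eq_iff[of u i "Suc i"] u by (auto simp: U_def)
      then have "schubert_coeff u P = 0"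
        using schubert_coeff_descent[of u i P] assms(3)[OF that] u that by (simp add: U_def)
      then show False using u by (simp add: U_def)
    qed
    then show "u \<in> schubert_index n" using u by (simp add: schubert_index_def U_def)
  qed
  moreover have "P = (\<Sum>u\<in>U. of_int (schubert_coeff u P) * schubert u)" (is "P = ?R")
  proof -
    have R: "?R = (\<Sum>u\<in>Poly_Mapping.keys c. of_int (Poly_Mapping.lookup c u) * schubert u)"
      unfolding keys by (rule sum.cong) (auto simp: lookup U_def)
    have "P - ?R = 0"
    proof (rule homogeneous_eq_0I)
      show "homogeneous d (P - ?R)"
      proof (intro homogeneous_diff homogeneous_sum homogeneous_of_int_mult assms(1))
        fix u assume "u \<in> U"
        then show "homogeneous d (schubert u)"
          using homogeneous_schubert[of u] schubert_coeff_homogeneous[of u d P] assms(1)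
          by (auto simp: U_def)
      qed
      show "in_x (P - ?R)"
        by (intro in_x_diff in_x_sum in_x_mult in_x_of_int assms(2))
          (use schubert_in_x_homogeneous in \<open>auto simp: U_def\<close>)
      fix v assume v: "v \<in> S_inf"
      have "schubert_coeff v ?R = Poly_Mapping.lookup c v"
        unfolding R by (rule coeff_sum) (use v in \<open>auto simp: keys U_def\<close>)
      then show "schubert_coeff v (P - ?R) = 0"
        using v by (simp add: schubert_coeff_diff lookup)
    qed
    then show ?thesis by simp
  qed
  moreover have "\<dots> = (\<Sum>u\<in>U. of_int (Poly_Mapping.lookup c u) * schubert u)"
    by (rule sum.cong) (auto simp: lookup U_def)
  ultimately have ex: "?expansion c" unfolding keys by simp
  show "\<exists>!c. ?expansion c"
  proof (rule ex1I[of ?expansion c, OF ex])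
    fix c' assume c': "?expansion c'"
    show "c' = c"
    proof (rule poly_mapping_eqI)
      fix v show "Poly_Mapping.lookup c' v = Poly_Mapping.lookup c v"
      proof (cases "v \<in> S_inf")
        case True
        then show ?thesis using coeff[OF c'] coeff[OF ex] by simp
      next
        case False
        then have "v \<notin> Poly_Mapping.keys c'" using c' index by blast
        then show ?thesis using False by (simp add: lookup in_keys_iff)
      qed
    qed
  qed
  show "Poly_Mapping.lookup c v = schubert_coeff v P" 
    if "Poly_Mapping.keys c \<subseteq> schubert_index n"
      "P = (\<Sum>u\<in>Poly_Mapping.keys c. of_int (Poly_Mapping.lookup c u) * schubert u)" "v \<in> S_inf" for c v
    using coeff that by blast
qed

lemma hessenberg_coeff_eq:
  assumes "k < n" "w \<in> S_inf"
  shows "hessenberg_coeff n k w = schubert_coeff w (\<Prod>j\<in>{1..k}. px 1 - px (n + 1 - j))"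
proof -
  let ?P = "\<Prod>j\<in>{1..k}. px 1 - px (n + 1 - j)"
  have hom: "homogeneous (card {1..k}) ?P"
    by (rule homogeneous_prod) (auto intro: homogeneous_diff)
  have inx: "in_x ?P"
    by (rule in_x_prod) (use assms(1) in \<open>auto intro!: in_x_diff\<close>)
  have dd: "dd i ?P = 0" if "n < i" for i
    unfolding dd_eq_0_iff swap_x_prod by (rule prod.cong) (use that assms(1) in auto)
  let ?expansion = "\<lambda>c. Poly_Mapping.keys c \<subseteq> schubert_index n \<and>
      ?P = (\<Sum>u\<in>Poly_Mapping.keys c. of_int (Poly_Mapping.lookup c u) * schubert u)"
  have "hessenberg_expansion n k = (THE c. ?expansion c)"
    unfolding hessenberg_expansion_def hessenberg_poly_eq ..
  moreover have "?expansion (THE c. ?expansion c)"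
    by (rule theI'[OF schubert_expansion(1)[OF hom inx dd]])
  ultimately have "?expansion (hessenberg_expansion n k)" by simp
  then show ?thesis
    unfolding hessenberg_coeff_def
    by (intro schubert_expansion(2)[OF hom inx dd]) (use assms(2) in auto)
qed

section \<open>Complete homogeneous symmetric polynomials\<close>

text \<open>\<open>complete_sym r m\<close> is $h_r(x_1, \ldots, x_m)$; the recursion separates the monomials divisible by the
  last variable.\<close>

fun complete_sym :: "nat \<Rightarrow> nat \<Rightarrow> xypoly" where
  "complete_sym 0 m = 1"
| "complete_sym (Suc r) 0 = 0"
| "complete_sym (Suc r) (Suc m) = complete_sym (Suc r) m + px (Suc m) * complete_sym r (Suc m)"

lemma const_term_complete_sym: "const_term (complete_sym (Suc r) m) = 0"
  by (induction m) (simp_all add: const_term_add const_term_mult)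

lemma dd_complete_sym_beyond: "m < i \<Longrightarrow> dd i (complete_sym r m) = 0"
  by (induction r m rule: complete_sym.induct) (simp_all add: dd_add dd_px_mult)

lemma dd_complete_sym_last: "dd (Suc m) (complete_sym (Suc r) (Suc m)) = complete_sym r (Suc (Suc m))"
  by (induction r) (simp_all add: dd_add dd_px dd_px_mult dd_complete_sym_beyond)

text \<open>For \<open>i = m - 1\<close> symmetry holds because the polynomial is itself a divided difference at \<open>i\<close>.\<close>

lemma dd_complete_sym_below: "1 \<le> i \<Longrightarrow> i < m \<Longrightarrow> dd i (complete_sym r m) = 0"
proof (induction r m rule: complete_sym.induct)
  case (3 r m)
  show ?case
  proof (cases "i = m")
    case True
    then obtain m' where "m = Suc m'" using 3 by (cases m) auto
    then show ?thesis using True dd_complete_sym_last[of m' "Suc r"] dd_dd by metis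
  next
    case False
    then show ?thesis using 3 by (simp add: dd_add dd_px_mult)
  qed
qed simp_all

lemma dd_complete_sym:
  "1 \<le> i \<Longrightarrow> dd i (complete_sym (Suc r) m) = (if i = m then complete_sym r (Suc m) else 0)"
  using dd_complete_sym_beyond[of m i "Suc r"] dd_complete_sym_below[of i m "Suc r"] 
    dd_complete_sym_last[of "m - 1" r]
  by (cases "i < m"; cases "i = m") auto

text \<open>The product $s_{m+r-1} \cdots s_{m+1} s_m$. It is Grassmannian with descent at \<open>m\<close>, and its Schubert
  polynomial is $h_r(x_1, \ldots, x_m)$.\<close>

definition cycle_perm :: "nat \<Rightarrow> nat \<Rightarrow> nat \<Rightarrow> nat" where
  "cycle_perm r m = descending_product (m + r - 1) m"

lemma foldr_comp_id: "foldr (\<circ>) fs g = foldr (\<circ>) fs id \<circ> g"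
proof (induction fs)
  case (Cons f fs)
  have "foldr (\<circ>) (f # fs) h = f \<circ> foldr (\<circ>) fs h" for h by simp
  then show ?case using Cons.IH by (metis comp_assoc)
qed simp

lemma cycle_perm_0: "1 \<le> m \<Longrightarrow> cycle_perm 0 m = id"
  by (simp add: cycle_perm_def descending_product_def)

lemma cycle_perm_Suc:
  assumes "1 \<le> m"
  shows "cycle_perm (Suc r) m = cycle_perm r (Suc m) \<circ> simple_transp m"
proof -
  have "[m..<m + Suc r - 1 + 1] = m # [Suc m..<Suc m + r - 1 + 1]"
    using assms by (simp add: upt_conv_Cons)
  then have "map simple_transp (rev [m..<m + Suc r - 1 + 1]) = 
      map simple_transp (rev [Suc m..<Suc m + r - 1 + 1]) @ [simple_transp m]" by simp
  then have "cycle_perm (Suc r) m = 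
      foldr (\<circ>) (map simple_transp (rev [Suc m..<Suc m + r - 1 + 1]) @ [simple_transp m]) id"
    by (simp only: cycle_perm_def descending_product_def)
  also have "\<dots> = foldr (\<circ>) (map simple_transp (rev [Suc m..<Suc m + r - 1 + 1])) (simple_transp m)"
    unfolding foldr_append by simp
  also have "\<dots> = cycle_perm r (Suc m) \<circ> simple_transp m"
    unfolding cycle_perm_def descending_product_def by (rule foldr_comp_id)
  finally show ?thesis .
qed

lemma cycle_perm_apply:
  "1 \<le> m \<Longrightarrow> cycle_perm r m j = (if j = m then m + r else if m < j \<and> j \<le> m + r then j - 1 else j)"
proof (induction r arbitrary: m j)
  case (Suc r)
  show ?case
    unfolding cycle_perm_Suc[OF Suc.prems] comp_apply
    using Suc.IH[of "Suc m" "simple_transp m j"] by (auto simp: simple_transp_def transpose_def)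
qed (simp add: cycle_perm_0)

text \<open>The recursion $\partial_m h_{r+1}(x_1, \ldots, x_m) = h_r(x_1, \ldots, x_{m+1})$ matches the
  factorisation of the cycle, and at all other places both the polynomial is symmetric and the cycle
  has no descent.\<close>

lemma schubert_coeff_complete_sym:
  assumes "u \<in> S_inf" "1 \<le> m"
  shows "schubert_coeff u (complete_sym r m) = (if u = cycle_perm r m then 1 else 0)"
  using assms
proof (induction r arbitrary: u m)
  case 0
  show ?case
    using schubert_coeff_schubert[OF 0(1) id_S_inf] 0(2) unfolding schubert_id
    by (metis complete_sym.simps(1) cycle_perm_0)
next
  case (Suc r)
  show ?case
  proof (cases "u = id")
    case True
    have "cycle_perm (Suc r) m m \<noteq> id m" using Suc.prems by (simp add: cycle_perm_apply)
    then have "u \<noteq> cycle_perm (Suc r) m" using True by metis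
    then show ?thesis using True const_term_complete_sym by (simp only: schubert_coeff_id) simp
  next
    case False
    then obtain i where i: "1 \<le> i" "u (Suc i) < u i" using descent_exists Suc.prems(1) by blast
    have coeff: "schubert_coeff u (complete_sym (Suc r) m) = 
        schubert_coeff (u \<circ> simple_transp i) (if i = m then complete_sym r (Suc m) else 0)"
      unfolding schubert_coeff_descent[OF Suc.prems(1) i(2)] dd_complete_sym[OF i(1)] ..
    have S: "u \<circ> simple_transp i \<in> S_inf" using Suc.prems i by simp
    show ?thesis
    proof (cases "i = m")
      case True
      have "u = cycle_perm (Suc r) m \<longleftrightarrow> u \<circ> simple_transp i = cycle_perm r (Suc m)"
        unfolding True cycle_perm_Suc[OF Suc.prems(2)] by (metis comp_simple_transp_cancel)
      moreover have "schubert_coeff u (complete_sym (Suc r) m) =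
          (if u \<circ> simple_transp i = cycle_perm r (Suc m) then 1 else 0)"
        unfolding coeff if_P[OF True] by (rule Suc.IH[OF S]) simp
      ultimately show ?thesis by metis
    next
      case False
      have "\<not> cycle_perm (Suc r) m (Suc i) < cycle_perm (Suc r) m i"
        using False Suc.prems(2) by (auto simp: cycle_perm_apply)
      then have "u \<noteq> cycle_perm (Suc r) m" using i by metis
      then show ?thesis using coeff False S by simp
    qed
  qed
qed

section \<open>Multiplication by a variable\<close>

lemma dd_perm_uminus: "w \<in> S_inf \<Longrightarrow> dd_perm w (- f) = - dd_perm w f"
  using dd_perm_diff[of w 0 f] by simp

text \<open>The contribution of the transposition $(m\;j)$ to the commutator of $\partial_w$ with $x_m$: it is nonzero
  only if the transposition lowers the length by exactly one, and its sign tells on which side of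
  \<open>m\<close> the place \<open>j\<close> lies.\<close>

definition chevalley_term :: "(nat \<Rightarrow> nat) \<Rightarrow> nat \<Rightarrow> nat \<Rightarrow> xypoly \<Rightarrow> xypoly" where
  "chevalley_term w m j f =
    (if inversions (w \<circ> transpose m j) + 1 = inversions w
     then (if m < j then dd_perm (w \<circ> transpose m j) f else - dd_perm (w \<circ> transpose m j) f)
     else 0)"

text \<open>Passing from \<open>w\<close> to \<open>w s\<^sub>i\<close> conjugates all transpositions by $s_i$. The covers correspond to each other by
  \<open>cover_keeps_descent\<close>, except that $s_i$ itself is a cover for \<open>w\<close> only; this is the term that the
  Leibniz rule creates.\<close>

lemma chevalley_term_descent:
  assumes w: "w \<in> S_inf" and i: "1 \<le> i" "w (Suc i) < w i" and mj: "1 \<le> m" "1 \<le> j"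
  shows "chevalley_term w m j f = 
      chevalley_term (w \<circ> simple_transp i) (simple_transp i m) (simple_transp i j) (dd i f) +
      (if m = i \<and> j = Suc i then dd_perm (w \<circ> simple_transp i) f
       else if m = Suc i \<and> j = i then - dd_perm (w \<circ> simple_transp i) f else 0)"
proof -
  let ?s = "simple_transp i"
  let ?v = "w \<circ> ?s" and ?u = "w \<circ> transpose m j"
  have len: "inversions w = Suc (inversions ?v)" using inversions_descent[OF w i(2,1)] .
  consider "m = i \<and> j = Suc i" | "m = Suc i \<and> j = i" | "m = j" 
    | "m \<noteq> j" "\<not> (m = i \<and> j = Suc i)" "\<not> (m = Suc i \<and> j = i)" by blast
  then show ?thesis
  proof cases
    case 1
    have t: "transpose m j = ?s" "transpose (?s m) (?s j) = ?s"
      using 1 by (auto simp: simple_transp_def transpose_commute)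
    have "?v \<circ> ?s = w" by simp
    then show ?thesis
      using 1 len unfolding chevalley_term_def t by (simp del: comp_simple_transp_cancel)
  next
    case 2
    have t: "transpose m j = ?s" "transpose (?s m) (?s j) = ?s"
      using 2 by (auto simp: simple_transp_def transpose_commute)
    have "?v \<circ> ?s = w" by simp
    then show ?thesis
      using 2 len unfolding chevalley_term_def t by (simp del: comp_simple_transp_cancel)
  next
    case 3
    have "x \<circ> transpose y y = x" for x :: "nat \<Rightarrow> nat" and y by simp
    then show ?thesis using 3 unfolding chevalley_term_def by auto
  next
    case 4
    have conj: "?v \<circ> transpose (?s m) (?s j) = ?u \<circ> ?s"
      by (auto simp: simple_transp_def transpose_def fun_eq_iff)
    have order: "?s m < ?s j \<longleftrightarrow> m < j"
      using 4 by (auto simp: simple_transp_def transpose_def)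
    obtain n where "w permutes {1..n}" using w by (auto simp: S_inf_def)
    then have "w permutes {1..n + m + j}" by (rule permutes_mono) simp
    then have "?u permutes {1..n + m + j}" by (rule comp_transpose_permutes) (use mj in auto)
    then have u: "?u \<in> S_inf" by (rule permutes_S_inf)
    then have us: "?u \<circ> ?s \<in> S_inf" using i by simp
    have D: "dd_perm (?u \<circ> ?s) (dd i f) = (if ?u (Suc i) < ?u i then dd_perm ?u f else 0)"
      unfolding dd_perm_dd[OF us i(1)] by simp
    have "chevalley_term w m j f = chevalley_term ?v (?s m) (?s j) (dd i f)"
    proof (cases "?u (Suc i) < ?u i")
      case True
      then have "inversions ?u = Suc (inversions (?u \<circ> ?s))"
        using inversions_descent[OF u _ i(1)] by blast
      then show ?thesis
        using True unfolding chevalley_term_def conj order D len by simp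
    next
      case False
      have "inversions ?u + 1 \<noteq> inversions w"
      proof
        assume *: "inversions ?u + 1 = inversions w"
        have "?u (Suc i) < ?u i"
        proof (cases "m < j")
          case True
          then show ?thesis
            using cover_keeps_descent[OF w mj(1) True * i(2)] 4 by blast
        next
          case False
          then have "j < m" using 4 by simp
          then show ?thesis
            using cover_keeps_descent[OF w mj(2), of m i] * i(2) 4
            by (metis transpose_commute prod.inject)
        qed
        then show False using \<open>\<not> ?u (Suc i) < ?u i\<close> by blast
      qed
      then show ?thesis
        using False unfolding chevalley_term_def conj order D by simp
    qed
    then show ?thesis using 4 by auto
  qed
qed

text \<open>The Chevalley--Monk formula, in the dual form of a commutation rule for $\partial_w$.\<close>

lemma dd_perm_px_mult:
  assumes "w permutes {1..n}" "m \<in> {1..n}"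
  shows "dd_perm w (px m * f) = px (w m) * dd_perm w f + (\<Sum>j\<in>{1..n}. chevalley_term w m j f)"
proof -
  have "w \<in> S_inf" using assms(1) by (rule permutes_S_inf)
  then show ?thesis using assms
  proof (induction w arbitrary: m f rule: S_inf_descent_induct)
    case id
    show ?case unfolding chevalley_term_def inversions_id dd_perm_id by simp
  next
    case (descent w i)
    let ?s = "simple_transp i"
    let ?v = "w \<circ> ?s"
    have i: "i < n" using descent_bound[OF descent.prems(1) descent.hyps(3)] .
    have v: "?v permutes {1..n}"
      using comp_simple_transp_permutes[OF descent.prems(1) descent.hyps(2) i] .
    then have vS: "?v \<in> S_inf" by (rule permutes_S_inf)
    have s: "?s permutes {1..n}" using simple_transp_permutes[OF descent.hyps(2) i] .
    have sm: "?s m \<in> {1..n}" using permutes_in_image[OF s] descent.prems(2) by blast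
    define E where "E = (if m = i then dd_perm ?v f else if m = Suc i then - dd_perm ?v f else 0)"
    have "dd_perm w (px m * f) = dd_perm ?v (dd i (px m * f))"
      by (rule dd_perm_descent[OF descent.hyps(1,3)])
    also have "\<dots> = dd_perm ?v (px (?s m) * dd i f) + E"
      unfolding dd_px_mult dd_perm_add[OF vS] E_def using vS dd_perm_uminus[OF vS] by auto
    also have "dd_perm ?v (px (?s m) * dd i f) = 
        px (?v (?s m)) * dd_perm ?v (dd i f) + (\<Sum>j\<in>{1..n}. chevalley_term ?v (?s m) j (dd i f))"
      by (rule descent.IH[OF v sm])
    also have "?v (?s m) = w m" by simp
    also have "dd_perm ?v (dd i f) = dd_perm w f"
      by (rule dd_perm_descent[OF descent.hyps(1,3), symmetric])
    also have "(\<Sum>j\<in>{1..n}. chevalley_term ?v (?s m) j (dd i f)) = 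
        (\<Sum>j\<in>{1..n}. chevalley_term ?v (?s m) (?s j) (dd i f))"
      using sum.permute[OF s, of "\<lambda>j. chevalley_term ?v (?s m) j (dd i f)"] 
      unfolding comp_def .
    finally have 1: "dd_perm w (px m * f) = px (w m) * dd_perm w f + 
        ((\<Sum>j\<in>{1..n}. chevalley_term ?v (?s m) (?s j) (dd i f)) + E)"
      by (simp only: add.assoc)
    have "(\<Sum>j\<in>{1..n}. chevalley_term w m j f) = 
      (\<Sum>j\<in>{1..n}. chevalley_term ?v (?s m) (?s j) (dd i f) + 
        (if m = i \<and> j = Suc i then dd_perm ?v f else if m = Suc i \<and> j = i then - dd_perm ?v f else 0))"
      by (rule sum.cong[OF refl], rule chevalley_term_descent[OF descent.hyps]) 
        (use descent.prems(2) in auto)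
    also have "\<dots> = (\<Sum>j\<in>{1..n}. chevalley_term ?v (?s m) (?s j) (dd i f)) + 
        (\<Sum>j\<in>{1..n}. if m = i \<and> j = Suc i then dd_perm ?v f 
          else if m = Suc i \<and> j = i then - dd_perm ?v f else 0)"
      by (rule sum.distrib)
    also have "(\<Sum>j\<in>{1..n}. if m = i \<and> j = Suc i then dd_perm ?v f 
          else if m = Suc i \<and> j = i then - dd_perm ?v f else 0) = E"
    proof -
      consider "m = i" | "m = Suc i" | "m \<noteq> i" "m \<noteq> Suc i" by blast
      then show ?thesis
      proof cases
        case 1
        show ?thesis unfolding E_def 1 using i by (simp cong: if_cong)
      next
        case 2
        show ?thesis unfolding E_def 2 using i descent.hyps(2) by (simp cong: if_cong)
      qed (simp add: E_def)
    qed
    finally have 2: "(\<Sum>j\<in>{1..n}. chevalley_term w m j f) =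
        (\<Sum>j\<in>{1..n}. chevalley_term ?v (?s m) (?s j) (dd i f)) + E" .
    show ?case unfolding 1 2 ..
  qed
qed

text \<open>For the first variable all signs are positive, and the term with the factor $x_{w(1)}$ has no
  constant term.\<close>

lemma schubert_coeff_px_1_mult:
  assumes "w permutes {1..n}" "1 \<le> n"
  shows "schubert_coeff w (px 1 * f) =
    (\<Sum>j\<in>{j\<in>{2..n}. inversions (w \<circ> transpose 1 j) + 1 = inversions w}.
      schubert_coeff (w \<circ> transpose 1 j) f)"
proof -
  have "{1..n} = insert 1 {2..n}" using assms(2) by auto
  then have "(\<Sum>j\<in>{1..n}. chevalley_term w 1 j f) = (\<Sum>j\<in>{2..n}. chevalley_term w 1 j f)"
    by (simp add: chevalley_term_def)
  moreover have "1 \<in> {1..n}" using assms(2) by simp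
  ultimately have "schubert_coeff w (px 1 * f) = (\<Sum>j\<in>{2..n}. const_term (chevalley_term w 1 j f))"
    unfolding schubert_coeff_def using dd_perm_px_mult[OF assms(1), of 1 f]
    by (simp add: const_term_add const_term_mult const_term_sum)
  also have "\<dots> = (\<Sum>j\<in>{2..n}. if inversions (w \<circ> transpose 1 j) + 1 = inversions w 
      then schubert_coeff (w \<circ> transpose 1 j) f else 0)"
    by (rule sum.cong) (auto simp: chevalley_term_def schubert_coeff_def)
  finally show ?thesis by (simp only: sum.inter_filter[OF finite_atLeastAtMost])
qed

section \<open>Counting restricted paths\<close>

definition paths :: "nat \<Rightarrow> nat \<Rightarrow> (nat \<Rightarrow> nat) \<Rightarrow> (nat \<Rightarrow> nat) \<Rightarrow> (nat \<Rightarrow> nat) list set" where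
  "paths n p u v = {us. length us = p \<and> restricted_path n us u v}"

lemma paths_1: "w permutes {1..n} \<Longrightarrow> paths n (Suc 0) w v = (if w = v then {[w]} else {})"
  by (auto simp: paths_def restricted_path_def length_Suc_conv)

lemma restricted_path_Cons:
  "restricted_path n (x # y # us) w v \<longleftrightarrow>
    x = w \<and> w permutes {1..n} \<and> inversions y + 1 = inversions w \<and> 
    (\<exists>j\<in>{2..n}. y = w \<circ> transpose 1 j) \<and> restricted_path n (y # us) y v"
proof -
  have split: "(\<forall>i. i + 1 < length (x # y # us) \<longrightarrow> Q ((x # y # us) ! i) ((x # y # us) ! (i + 1))) \<longleftrightarrow>
    Q x y \<and> (\<forall>i. i + 1 < length (y # us) \<longrightarrow> Q ((y # us) ! i) ((y # us) ! (i + 1)))" for Q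
  proof
    assume *: "\<forall>i. i + 1 < length (x # y # us) \<longrightarrow> Q ((x # y # us) ! i) ((x # y # us) ! (i + 1))"
    have "Q x y" using *[rule_format, of 0] by simp
    moreover have "Q ((y # us) ! i) ((y # us) ! (i + 1))" if "i + 1 < length (y # us)" for i
      using *[rule_format, of "Suc i"] that by simp
    ultimately show "Q x y \<and> (\<forall>i. i + 1 < length (y # us) \<longrightarrow> Q ((y # us) ! i) ((y # us) ! (i + 1)))"
      by blast
  next
    assume *: "Q x y \<and> (\<forall>i. i + 1 < length (y # us) \<longrightarrow> Q ((y # us) ! i) ((y # us) ! (i + 1)))"
    show "\<forall>i. i + 1 < length (x # y # us) \<longrightarrow> Q ((x # y # us) ! i) ((x # y # us) ! (i + 1))"
    proof (intro allI impI)
      fix i assume "i + 1 < length (x # y # us)"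
      then show "Q ((x # y # us) ! i) ((x # y # us) ! (i + 1))"
        using * by (cases i) auto
    qed
  qed
  show ?thesis
    unfolding restricted_path_def
    using split[of "\<lambda>a b. inversions b + 1 = inversions a \<and> (\<exists>j\<in>{2..n}. b = a \<circ> transpose 1 j)"]
    by auto
qed

lemma paths_Suc:
  assumes "w permutes {1..n}"
  shows "paths n (Suc (Suc p)) w v =
    (\<Union>j\<in>{j\<in>{2..n}. inversions (w \<circ> transpose 1 j) + 1 = inversions w}.
      (#) w ` paths n (Suc p) (w \<circ> transpose 1 j) v)" (is "?L = ?R")
proof (intro set_eqI iffI)
  fix us assume us: "us \<in> ?L"
  then obtain x y us' where *: "us = x # y # us'" "length us' = p"
    by (auto simp: paths_def length_Suc_conv)
  with us show "us \<in> ?R" by (auto simp: paths_def restricted_path_Cons)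
next
  fix us assume "us \<in> ?R"
  then obtain j us' where j: "j \<in> {2..n}" "inversions (w \<circ> transpose 1 j) + 1 = inversions w"
    and us: "us = w # us'" "length us' = Suc p" "restricted_path n us' (w \<circ> transpose 1 j) v"
    by (auto simp: paths_def)
  then obtain y us'' where "us' = y # us''" by (auto simp: length_Suc_conv)
  moreover from this have "y = w \<circ> transpose 1 j" using us by (simp add: restricted_path_def)
  ultimately show "us \<in> ?L"
    using j us assms by (auto simp: paths_def restricted_path_Cons)
qed

text \<open>Each factor $x_1$ is one step of a restricted path; the remaining polynomial \<open>h\<close> only sees the
  endpoint \<open>v\<close>.\<close>

lemma schubert_coeff_paths:
  assumes "w permutes {1..n}" "1 \<le> n"
    and "\<And>u. u permutes {1..n} \<Longrightarrow> schubert_coeff u h = (if u = v then 1 else 0)"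
  shows "finite (paths n (Suc p) w v) \<and> schubert_coeff w (px 1 ^ p * h) = int (card (paths n (Suc p) w v))"
  using assms(1)
proof (induction p arbitrary: w)
  case 0
  then show ?case using assms(3)[OF 0] by (simp add: paths_1)
next
  case (Suc p)
  let ?J = "{j\<in>{2..n}. inversions (w \<circ> transpose 1 j) + 1 = inversions w}"
  let ?B = "\<lambda>j. (#) w ` paths n (Suc p) (w \<circ> transpose 1 j) v"
  have perm: "(w \<circ> transpose 1 j) permutes {1..n}" if "j \<in> ?J" for j
    by (rule comp_transpose_permutes[OF Suc.prems]) (use that assms(2) in auto)
  have fin: "finite (?B j)" if "j \<in> ?J" for j
    by (intro finite_imageI conjunct1[OF Suc.IH] perm that)
  have inj: "inj w" using Suc.prems permutes_inj by blast
  have disj: "?B j \<inter> ?B j' = {}" if "j \<in> ?J" "j' \<in> ?J" "j \<noteq> j'" for j j'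
  proof -
    have "(w \<circ> transpose 1 j) 1 \<noteq> (w \<circ> transpose 1 j') 1" using inj that by (simp add: inj_eq)
    then have "w \<circ> transpose 1 j \<noteq> w \<circ> transpose 1 j'" by metis
    then show ?thesis by (auto simp: paths_def restricted_path_def)
  qed
  have "int (card (paths n (Suc (Suc p)) w v)) = int (\<Sum>j\<in>?J. card (?B j))"
    unfolding paths_Suc[OF Suc.prems] using fin disj by (subst card_UN_disjoint) auto
  also have "\<dots> = (\<Sum>j\<in>?J. int (card (paths n (Suc p) (w \<circ> transpose 1 j) v)))"
    by (simp add: card_image)
  also have "\<dots> = (\<Sum>j\<in>?J. schubert_coeff (w \<circ> transpose 1 j) (px 1 ^ p * h))"
    by (rule sum.cong[OF refl], rule conjunct2[OF Suc.IH, symmetric], rule perm)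
  also have "\<dots> = schubert_coeff w (px 1 * (px 1 ^ p * h))"
    by (rule schubert_coeff_px_1_mult[OF Suc.prems assms(2), symmetric])
  finally show ?case
    unfolding paths_Suc[OF Suc.prems] using fin by (simp add: mult.assoc)
qed

section \<open>Reduction modulo symmetric polynomials\<close>

text \<open>The ideal of polynomials that no functional indexed by $S_n$ can detect, even after
  multiplication. It contains the symmetric polynomials without constant term, so that
  $\prod_{i=1}^n (1 - x_i t) = 1$ modulo this ideal.\<close>

definition invisible :: "nat \<Rightarrow> xypoly \<Rightarrow> bool" where
  "invisible n A \<longleftrightarrow> (\<forall>w g. w permutes {1..n} \<longrightarrow> schubert_coeff w (A * g) = 0)"

lemma invisible_diff: "invisible n A \<Longrightarrow> invisible n B \<Longrightarrow> invisible n (A - B)"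
  using permutes_S_inf by (simp add: invisible_def left_diff_distrib schubert_coeff_diff)

lemma invisible_mult: "invisible n A \<Longrightarrow> invisible n (B * A)"
  unfolding invisible_def by (metis mult.assoc mult.commute)

lemma invisible_sum: "(\<And>a. a \<in> S \<Longrightarrow> invisible n (g a)) \<Longrightarrow> invisible n (sum g S)"
  using permutes_S_inf by (simp add: invisible_def sum_distrib_right schubert_coeff_sum)

lemma invisible_symmetric:
  assumes "\<And>i. 1 \<le> i \<Longrightarrow> i < n \<Longrightarrow> dd i A = 0" "const_term A = 0"
  shows "invisible n A"
  unfolding invisible_def schubert_coeff_def
  using dd_perm_symmetric_mult[OF _ assms(1)] assms(2) by (simp add: const_term_mult)

text \<open>The coefficient of $t^r$ in $1 / \big((1 - x_1 t) \prod_{i=1}^m (1 - x_i t)\big)$.\<close>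

definition path_poly :: "nat \<Rightarrow> nat \<Rightarrow> xypoly" where
  "path_poly r m = (\<Sum>b\<le>r. px 1 ^ (r - b) * complete_sym b m)"

lemma path_poly_Suc: 
  "path_poly (Suc r) (Suc m) = path_poly (Suc r) m + px (Suc m) * path_poly r (Suc m)"
  unfolding path_poly_def sum.atMost_Suc_shift
  by (simp add: sum.distrib sum_distrib_left algebra_simps)

text \<open>Modulo the ideal, $1 / \prod_{i \le m} (1 - x_i t) = \prod_{m < i \le n} (1 - x_i t)$. Dividing by
  $1 - x_1 t$ and reading off the coefficient of $t^r$ evaluates the right-hand side at $t = 1/x_1$, up
  to a power of $x_1$. The induction multiplies by one factor $1 - x_i t$ at a time, starting from
  $m = n$, where all $h_b$ with $b > 0$ are invisible.\<close>

lemma path_poly_congruence: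
  assumes "m \<le> n" "n - m \<le> r"
  shows "invisible n (path_poly r m - px 1 ^ (r - (n - m)) * (\<Prod>i\<in>{Suc m..n}. px 1 - px i))"
  using assms
proof (induction m arbitrary: r rule: inc_induct)
  case base
  have "path_poly r n = px 1 ^ r + (\<Sum>b\<in>{1..r}. px 1 ^ (r - b) * complete_sym b n)"
    unfolding path_poly_def atMost_atLeast0 by (subst sum.atLeast_Suc_atMost) auto
  moreover have "invisible n (\<Sum>b\<in>{1..r}. px 1 ^ (r - b) * complete_sym b n)"
  proof (intro invisible_sum invisible_mult invisible_symmetric)
    fix b assume "b \<in> {1..r}"
    then obtain c where "b = Suc c" by (cases b) auto
    then show "const_term (complete_sym b n) = 0" by (simp add: const_term_complete_sym)
  qed (rule dd_complete_sym_below)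
  ultimately show ?case by simp
next
  case (step m)
  then obtain q where r: "r = Suc q" by (cases r) auto
  define e where "e = q - (n - Suc m)"
  define G where "G = (\<Prod>i\<in>{Suc (Suc m)..n}. px 1 - px i)"
  have e: "r - (n - m) = e" "Suc q - (n - Suc m) = Suc e"
    using step.prems step.hyps r by (auto simp: e_def)
  have "{Suc m..n} = insert (Suc m) {Suc (Suc m)..n}" using step.hyps by auto
  then have G: "(\<Prod>i\<in>{Suc m..n}. px 1 - px i) = (px 1 - px (Suc m)) * G"
    by (simp add: G_def)
  have "invisible n (path_poly (Suc q) (Suc m) - px 1 ^ Suc e * G)"
    using step.IH[of "Suc q"] step.prems r e unfolding G_def by simp
  moreover have "invisible n (path_poly q (Suc m) - px 1 ^ e * G)"
    using step.IH[of q] step.prems r unfolding G_def e_def by simp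
  ultimately have "invisible n ((path_poly (Suc q) (Suc m) - px 1 ^ Suc e * G) - 
      px (Suc m) * (path_poly q (Suc m) - px 1 ^ e * G))"
    by (rule invisible_diff[OF _ invisible_mult])
  moreover have "(path_poly (Suc q) (Suc m) - px 1 ^ Suc e * G) - 
      px (Suc m) * (path_poly q (Suc m) - px 1 ^ e * G) =
      path_poly r m - px 1 ^ (r - (n - m)) * (\<Prod>i\<in>{Suc m..n}. px 1 - px i)"
    unfolding e(1)[unfolded r] G r path_poly_Suc by (simp add: algebra_simps)
  ultimately show ?case by simp
qed

lemma schubert_coeff_eq_if_invisible:
  assumes "w permutes {1..n}" "invisible n (A - B)"
  shows "schubert_coeff w A = schubert_coeff w B"
proof -
  have "schubert_coeff w ((A - B) * 1) = 0" using assms unfolding invisible_def by blast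
  then show ?thesis using permutes_S_inf[OF assms(1)] by (simp add: schubert_coeff_diff)
qed

section \<open>Hessenberg coefficients of one-row partitions\<close>

theorem theorem6p3:
  fixes n k :: nat and w :: "nat \<Rightarrow> nat"
  assumes "1 \<le> k" and "k \<le> n - 1"
    and "w permutes {1..n}" and "inversions w = k"
  shows "hessenberg_coeff n k w =
    int (card {us. \<exists>p\<in>{1..k + 1}. length us = p \<and>
      restricted_path n us w (descending_product (n - p) (n - k))})"
proof -
  define m where "m = n - k"
  have kn: "k < n" "1 \<le> m" "1 \<le> n" "m \<le> n" "k - (n - m) = 0" using assms(1,2) by (auto simp: m_def)
  have S: "w \<in> S_inf" using assms(3) by (rule permutes_S_inf)
  have coeff: "finite (paths n (Suc (k - b)) w (cycle_perm b m)) \<and> 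
      schubert_coeff w (px 1 ^ (k - b) * complete_sym b m) = 
      int (card (paths n (Suc (k - b)) w (cycle_perm b m)))" for b
    by (rule schubert_coeff_paths[OF assms(3) kn(3)])
      (rule schubert_coeff_complete_sym[OF permutes_S_inf kn(2)])
  have prod: "(\<Prod>j\<in>{1..k}. px 1 - px (n + 1 - j)) = (\<Prod>i\<in>{Suc m..n}. px 1 - px i)"
    by (rule prod.reindex_bij_witness[of _ "\<lambda>i. n + 1 - i" "\<lambda>j. n + 1 - j"]) 
      (use kn in \<open>auto simp: m_def\<close>)
  \<comment> \<open>The summand with \<open>x\<^sub>1\<^bsup>k-b\<^esup>\<close> counts the paths with \<open>p = k - b + 1\<close> terms, and then
     \<open>n - p = m + b - 1\<close>.\<close>
  have "hessenberg_coeff n k w = schubert_coeff w (\<Prod>i\<in>{Suc m..n}. px 1 - px i)"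
    unfolding hessenberg_coeff_eq[OF kn(1) S] prod ..
  also have "\<dots> = schubert_coeff w (path_poly k m)"
    using path_poly_congruence[OF kn(4), of k] kn(5)
    by (intro schubert_coeff_eq_if_invisible[OF assms(3), symmetric]) (simp add: m_def)
  also have "\<dots> = (\<Sum>b\<le>k. int (card (paths n (Suc (k - b)) w (cycle_perm b m))))"
    unfolding path_poly_def schubert_coeff_sum[OF S] using coeff by simp
  also have "\<dots> = int (\<Sum>b\<in>{..k}. card (paths n (Suc (k - b)) w (cycle_perm b m)))" by simp
  also have "(\<Sum>b\<in>{..k}. card (paths n (Suc (k - b)) w (cycle_perm b m))) =
      card (\<Union>b\<in>{..k}. paths n (Suc (k - b)) w (cycle_perm b m))"
    by (rule card_UN_disjoint[symmetric]) (use coeff in \<open>auto simp: paths_def\<close>)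
  also have "(\<Union>b\<in>{..k}. paths n (Suc (k - b)) w (cycle_perm b m)) = 
      (\<Union>p\<in>{1..k + 1}. paths n p w (descending_product (n - p) m))"
  proof (rule SUP_eq)
    fix b assume "b \<in> {..k}"
    then have "Suc (k - b) \<in> {1..k + 1}" "n - Suc (k - b) = m + b - 1" using kn by (auto simp: m_def)
    then show "\<exists>p\<in>{1..k + 1}. paths n (Suc (k - b)) w (cycle_perm b m) \<subseteq> 
        paths n p w (descending_product (n - p) m)"
      unfolding cycle_perm_def by (intro bexI[of _ "Suc (k - b)"]) simp_all
  next
    fix p assume "p \<in> {1..k + 1}"
    then have "k + 1 - p \<in> {..k}" "p = Suc (k - (k + 1 - p))" "n - p = m + (k + 1 - p) - 1"
      using kn by (auto simp: m_def)
    then show "\<exists>b\<in>{..k}. paths n p w (descending_product (n - p) m) \<subseteq> 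
        paths n (Suc (k - b)) w (cycle_perm b m)"
      unfolding cycle_perm_def by (intro bexI[of _ "k + 1 - p"]) simp_all
  qed
  also have "\<dots> = {us. \<exists>p\<in>{1..k + 1}. length us = p \<and>
      restricted_path n us w (descending_product (n - p) (n - k))}"
    by (auto simp: paths_def m_def)
  finally show ?thesis .
qed

end
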